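(* Let $n$ be an integer with $1\leq n\leq 5$, and let $F_1,\ldots,F_n$ be linear forms in three variables in general position, defined over a number field $k$, with indices read in $\mathbb{Z}/n\mathbb{Z}$. Then there exists a ring of $S$-integers $\mathcal{O}_S$, for a finite set of places $S$ of $k$, such that the set of $(x,y,z)\in\mathcal{O}_S^3$ satisfying, for each $i\in\mathbb{Z}/n\mathbb{Z}$, the equality of ideals of $\mathcal{O}_S$ $$F_i(x,y,z)\cdot(x,y,z)=\big(F_{i-1}(x,y,z),F_i(x,y,z)\big)\cdot\big(F_i(x,y,z),F_{i+1}(x,y,z)\big)$$ is Zariski-dense (in $\mathbb{P}_2$ or, equivalently, in $\mathbb{A}^3$).
   Context: $S$ contains all the archimedean places of $k$. For $\alpha_1,\ldots,\alpha_h\in k$, $(\alpha_1,\ldots,\alpha_h)$ denotes the (fractional) ideal of $\mathcal{O}_S$ they generate. Linear forms in three variables are in general position if any three of them (or all of them, if there are fewer than three) are linearly independent. *)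

theory Defs
  imports "HOL-Analysis.Analysis" "HOL-Computational_Algebra.Polynomial"
begin

text \<open>Number fields: the whole type is finite-dimensional over the rationals.\<close>

definition number_field :: "'a::field_char_0 itself \<Rightarrow> bool" where
  "number_field _ \<longleftrightarrow>
     (\<exists>B. finite_dimensional_vector_space (\<lambda>(q::rat) (x::'a). of_rat q * x) B)"

text \<open>Places are equivalence classes of nontrivial absolute values.\<close>

definition absolute_value :: "('a::field \<Rightarrow> real) \<Rightarrow> bool" where
  "absolute_value v \<longleftrightarrow>
     (\<forall>x. 0 \<le> v x) \<and> (\<forall>x. v x = 0 \<longleftrightarrow> x = 0) \<and>
     (\<forall>x y. v (x * y) = v x * v y) \<and> (\<forall>x y. v (x + y) \<le> v x + v y)"

definition nontrivial_absolute_values :: "('a::field \<Rightarrow> real) set" where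
  "nontrivial_absolute_values = {v. absolute_value v \<and> (\<exists>x. x \<noteq> 0 \<and> v x \<noteq> 1)}"

definition absolute_value_equiv :: "(('a::field \<Rightarrow> real) \<times> ('a \<Rightarrow> real)) set" where
  "absolute_value_equiv =
     {(v, w). v \<in> nontrivial_absolute_values \<and> w \<in> nontrivial_absolute_values \<and>
              (\<exists>c>0. \<forall>x. w x = v x powr c)}"

definition places :: "('a::field \<Rightarrow> real) set set" where
  "places = nontrivial_absolute_values // absolute_value_equiv"

text \<open>Both quantifiers over a place below are independent of the representative.\<close>

definition archimedean_places :: "('a::field \<Rightarrow> real) set set" where
  "archimedean_places = {P \<in> places. \<forall>v\<in>P. \<not> (\<forall>x y. v (x + y) \<le> max (v x) (v y))}"

definition S_integers :: "('a::field \<Rightarrow> real) set set \<Rightarrow> 'a set" where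
  "S_integers S = {x. \<forall>P \<in> places - S. \<forall>v\<in>P. v x \<le> 1}"

text \<open>
  The (fractional) ideal of a subring \<open>R\<close> of the field generated by a set \<open>A\<close> of field elements;
  the zero ideal is included.
\<close>

definition ideal_gen :: "'a::field set \<Rightarrow> 'a set \<Rightarrow> 'a set" where
  "ideal_gen R A = {\<Sum>a\<in>T. c a * a | T c. finite T \<and> T \<subseteq> A \<and> c ` T \<subseteq> R}"

definition ideal_mult :: "'a::field set \<Rightarrow> 'a set \<Rightarrow> 'a set \<Rightarrow> 'a set" where
  "ideal_mult R I J = ideal_gen R {a * b | a b. a \<in> I \<and> b \<in> J}"

text \<open>
  A linear form in three variables is given by its coefficient vector \<open>a\<close>; its value at \<open>v\<close> is
  \<open>scalar_product a v\<close>. General position of the family \<open>F 0, \<dots>, F (n - 1)\<close>: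
\<close>

definition general_position :: "nat \<Rightarrow> (nat \<Rightarrow> 'a::field ^ 3) \<Rightarrow> bool" where
  "general_position n F \<longleftrightarrow>
     (\<forall>I \<subseteq> {..<n}. card I = min 3 n \<longrightarrow> inj_on F I \<and> vec.independent (F ` I))"

text \<open>
  Polynomials in three variables are elements of \<open>k[x][y][z]\<close>, where \<open>z\<close> is the outermost variable.
\<close>

definition eval3 :: "'a::comm_ring_1 poly poly poly \<Rightarrow> 'a ^ 3 \<Rightarrow> 'a" where
  "eval3 p v = poly (poly (poly p [:[:v $ 3:]:]) [:v $ 2:]) (v $ 1)"

definition zariski_closed :: "('a::field ^ 3) set \<Rightarrow> bool" where
  "zariski_closed Z \<longleftrightarrow> (\<exists>P. Z = {v. \<forall>p\<in>P. eval3 p v = 0})"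

definition zariski_dense :: "('a::field ^ 3) set \<Rightarrow> bool" where
  "zariski_dense X \<longleftrightarrow> (\<forall>Z. zariski_closed Z \<and> X \<subseteq> Z \<longrightarrow> Z = UNIV)"

end

theory Submission
  imports Defs
begin

text \<open>
  If the values at a point are \<open>F i = q (i - 1) q i\<close> up to units, indices modulo \<open>n\<close>, and all ideals
  \<open>(q (i - 1), q (i + 1))\<close> equal one ideal \<open>J\<close>, then \<open>(F (i - 1), F i) = q (i - 1) J\<close> and
  \<open>(x, y, z) = J\<^sup>2\<close>, so the required equalities hold. For \<open>n \<le> 3\<close> one takes \<open>q = 1\<close> and lets the
  forms be arbitrary units. For \<open>n = 5\<close>, blow up the points \<open>p i\<close> where the lines \<open>F i\<close> and \<open>F (i + 1)\<close>
  meet and contract the conic through them: this is a del Pezzo surface of degree 5, the lines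
  become an anticanonical pentagon, and the complement of the pentagon is the cluster variety of
  type \<open>A\<^sub>2\<close>. It contains a torus with coordinates \<open>u\<close>, \<open>v\<close>, the complement of the diagonals through
  \<open>p 0\<close>, on which the \<open>q i\<close> are explicit polynomials; for \<open>n = 4\<close> there is an even simpler family. It
  remains to take \<open>S\<close> such that 2 and the finitely many constants in these formulas are \<open>S\<close>-units, and
  to let the parameters be powers of 2.

  That \<open>S\<close> may be taken finite rests on weak approximation: at most \<open>[k : \<rat>]\<close> places induce the same
  order \<open>v p \<le> v q\<close> on the rationals.
\<close>

section \<open>Absolute values and their restriction to the rationals\<close>

text \<open>For three or more forms, the equality for \<open>i\<close> says that dividing
  \<open>F i\<close> by the ideals of \<open>p (i - 1)\<close> and \<open>p i\<close>, all taken
  relative to \<open>(x, y, z)\<close>, leaves a unit. So the solutions are integral points of the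
  plane blown up at the \<open>p i\<close>, with respect to the strict transforms of the lines, and
  \<open>q i\<close> acts as an equation of the exceptional curve over \<open>p i\<close>. From four
  forms on, making all forms units is hopeless: the linear relation between four of them would be a
  unit equation with four terms, whose solutions are not Zariski-dense. The parameter beyond
  \<open>u\<close> and \<open>v\<close> scales the point, as density is proved in affine space.
  Places are bare classes of absolute values, so it has to be shown that a nonzero element has value
  1 at all but finitely many of them. Ostrowski's argument tells which orders on the rationals
  occur: the usual one, and one for each residue characteristic.\<close>

lemma le_if_power_le_linear_mult_power:
  fixes x y C D :: real
  assumes "0 < y" and bound: "\<And>n. x ^ n \<le> (C + D * real n) * y ^ n"
  shows "x \<le> y"
proof (rule ccontr)
  assume "\<not> x \<le> y"
  define r where "r = x / y"
  have r: "1 < r"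
    using \<open>0 < y\<close> \<open>\<not> x \<le> y\<close> by (simp add: r_def)
  have "(\<lambda>n. C * inverse (r ^ n) + D * (real n / r ^ n)) \<longlonglongrightarrow> C * 0 + D * 0"
    using r by (intro tendsto_intros LIMSEQ_inverse_realpow_zero lim_n_over_pown) auto
  moreover have "C * inverse (r ^ n) + D * (real n / r ^ n) \<ge> 1" for n
  proof -
    have "r ^ n \<le> C + D * real n"
      using bound[of n] \<open>0 < y\<close> by (simp add: r_def power_divide field_simps)
    then show ?thesis
      using r by (simp add: field_simps)
  qed
  ultimately have "1 \<le> C * 0 + D * (0::real)"
    by (intro LIMSEQ_le_const) auto
  then show False
    by simp
qed

definition ultrametric :: "('a::field \<Rightarrow> real) \<Rightarrow> bool" where
  "ultrametric v \<longleftrightarrow> (\<forall>x y. v (x + y) \<le> max (v x) (v y))"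

locale absval =
  fixes v :: "'a::field_char_0 \<Rightarrow> real"
  assumes absolute_value: "absolute_value v"
begin

lemma nonneg [simp]: "0 \<le> v x"
  and eq_0_iff [simp]: "v x = 0 \<longleftrightarrow> x = 0"
  and mult: "v (x * y) = v x * v y"
  and triangle: "v (x + y) \<le> v x + v y"
  using absolute_value by (auto simp: absolute_value_def)

lemma zero [simp]: "v 0 = 0"
  by simp

lemma pos_iff [simp]: "0 < v x \<longleftrightarrow> x \<noteq> 0"
  using nonneg[of x] eq_0_iff[of x] by linarith

lemma le_zero_iff [simp]: "v x \<le> 0 \<longleftrightarrow> x = 0"
  using nonneg[of x] eq_0_iff[of x] by linarith

lemma one [simp]: "v 1 = 1"
  by (metis eq_0_iff mult mult_cancel_left1 mult.right_neutral zero_neq_one)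

lemma power: "v (x ^ n) = v x ^ n"
  by (induction n) (simp_all add: mult)

lemma minus [simp]: "v (- x) = v x"
proof -
  have "v (- 1) * v (- 1) = 1"
    by (simp flip: mult)
  then have "v (- 1) = 1"
    using nonneg[of "- 1"] by (metis abs_of_nonneg abs_mult_self_eq abs_square_eq_1 power2_eq_square)
  then show ?thesis
    using mult[of "- 1" x] by simp
qed

lemma diff_le: "v (x - y) \<le> v x + v y"
  using triangle[of x "- y"] by simp

lemma inverse: "v (inverse x) = inverse (v x)"
proof (cases "x = 0")
  case False
  then have "v x * v (inverse x) = 1"
    by (simp flip: mult)
  then show ?thesis
    by (metis inverse_unique)
qed simp

lemma divide: "v (x / y) = v x / v y"
  by (simp add: divide_inverse mult inverse)

lemma sum_le: "v (\<Sum>i\<in>I. f i) \<le> (\<Sum>i\<in>I. v (f i))"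
proof (induction I rule: infinite_finite_induct)
  case (insert i I)
  then show ?case
    using triangle[of "f i" "sum f I"] by simp
qed simp_all

lemma of_nat_le: "v (of_nat n) \<le> real n"
proof (induction n)
  case (Suc n)
  then show ?case
    using triangle[of 1 "of_nat n"] by simp
qed simp

lemma of_int_eq_of_nat: "v (of_int a) = v (of_nat (nat \<bar>a\<bar>))"
  by (cases a rule: int_cases2) simp_all

text \<open>The binomial expansion of \<open>(x + y) ^ n\<close> has \<open>n + 1\<close> terms,
  each of value at most \<open>m ^ n\<close>; the factor \<open>n + 1\<close> disappears on passing
  to \<open>n\<close>-th roots.\<close>

lemma ultrametric_if_of_nat_le_one:
  assumes le_1: "\<And>n. v (of_nat n) \<le> 1"
  shows "ultrametric v"
  unfolding ultrametric_def
proof (intro allI)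
  fix x y
  define m where "m = max (v x) (v y)"
  show "v (x + y) \<le> max (v x) (v y)"
  proof (cases "x = 0 \<and> y = 0")
    case False
    then have "0 < m"
      by (auto simp: m_def less_max_iff_disj)
    have "v (x + y) ^ n \<le> (1 + 1 * real n) * m ^ n" for n
    proof -
      have "v (x + y) ^ n = v (\<Sum>k\<le>n. of_nat (n choose k) * x ^ k * y ^ (n - k))"
        by (simp add: power[symmetric] binomial_ring)
      also have "\<dots> \<le> (\<Sum>k\<le>n. v (of_nat (n choose k) * x ^ k * y ^ (n - k)))"
        by (rule sum_le)
      also have "\<dots> \<le> (\<Sum>k\<le>n. m ^ n)"
      proof (rule sum_mono)
        fix k assume "k \<in> {..n}"
        have "v (of_nat (n choose k) * x ^ k * y ^ (n - k)) \<le> 1 * m ^ k * m ^ (n - k)"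
          unfolding mult power
          by (intro mult_mono power_mono le_1) (auto simp: m_def le_max_iff_disj)
        also have "\<dots> = m ^ n"
          using \<open>k \<in> {..n}\<close> by (simp flip: power_add)
        finally show "v (of_nat (n choose k) * x ^ k * y ^ (n - k)) \<le> m ^ n" .
      qed
      also have "\<dots> = (1 + 1 * real n) * m ^ n"
        by simp
      finally show ?thesis .
    qed
    then show ?thesis
      unfolding m_def[symmetric] by (rule le_if_power_le_linear_mult_power[OF \<open>0 < m\<close>])
  qed auto
qed

text \<open>Expanding \<open>m\<close> in base \<open>b\<close> yields about \<open>log b m\<close> digits, each of absolute value at most \<open>b\<close>.\<close>

lemma of_nat_le_base_expansion:
  assumes b: "2 \<le> b" and "1 \<le> m"
  defines "M \<equiv> max 1 (v (of_nat b))"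
  shows "v (of_nat m) \<le> real b * (log b m + 1) * M powr log b m"
  using \<open>1 \<le> m\<close>
proof (induction m rule: less_induct)
  case (less m)
  define L where "L = log b m"
  have L: "0 \<le> L"
    using b less.prems by (simp add: L_def)
  have M: "1 \<le> M"
    by (simp add: M_def)
  have one_le: "1 \<le> M powr L"
    using M L by (simp add: ge_one_powr_ge_zero)
  show ?case
  proof (cases "m < b")
    case True
    have "v (of_nat m) \<le> real b * 1 * 1"
      using of_nat_le[of m] True by simp
    also have "\<dots> \<le> real b * (L + 1) * M powr L"
      using L one_le by (intro mult_mono) auto
    finally show ?thesis
      by (simp add: L_def)
  next
    case False
    define q r where "q = m div b" and "r = m mod b"
    have m: "m = b * q + r"
      unfolding q_def r_def by (rule mult_div_mod_eq[symmetric])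
    have q: "1 \<le> q" "q < m"
      using False b less.prems div_greater_zero_iff[of m b] div_less_dividend[of b m]
      unfolding q_def by linarith+
    have "real b * real q \<le> real m"
      unfolding m by simp
    then have "log b (real b * real q) \<le> L"
      using b q by (simp add: L_def)
    then have lq: "log b q \<le> L - 1"
      using b q by (simp add: log_mult)
    have lq0: "0 \<le> log b q"
      using b q by simp
    have r: "v (of_nat r) \<le> real b"
    proof -
      have "real r \<le> real b"
        using b by (simp add: r_def less_imp_le)
      then show ?thesis
        using of_nat_le[of r] by linarith
    qed
    have "v (of_nat q) \<le> real b * (log b q + 1) * M powr log b q"
      using q by (intro less.IH)
    also have "\<dots> \<le> real b * L * M powr (L - 1)"
      using lq lq0 M b by (intro mult_mono powr_mono mult_left_mono) auto
    finally have "v (of_nat b) * v (of_nat q) \<le> M * (real b * L * M powr (L - 1))"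
      using M by (intro mult_mono) (auto simp: M_def)
    moreover have "M * (real b * L * M powr (L - 1)) = real b * L * M powr L"
      using M by (simp add: powr_diff)
    moreover have "real b \<le> real b * M powr L"
      using one_le b by simp
    moreover have "v (of_nat m) \<le> v (of_nat b) * v (of_nat q) + v (of_nat r)"
      using triangle[of "of_nat b * of_nat q" "of_nat r"] by (subst m) (simp add: mult)
    moreover have "real b * (L + 1) * M powr L = real b * L * M powr L + real b * M powr L"
      by (simp add: algebra_simps)
    ultimately show ?thesis
      using r unfolding L_def[symmetric] by linarith
  qed
qed

text \<open>In the digit bound for \<open>a ^ n\<close> the factor in front grows only linearly in
  \<open>n\<close>, so comparing \<open>n\<close>-th powers removes it. This is the key inequality
  of Ostrowski's theorem.\<close>

lemma of_nat_le_powr_log: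
  assumes b: "2 \<le> b" and a: "1 \<le> a"
  shows "v (of_nat a) \<le> max 1 (v (of_nat b)) powr log b a"
proof -
  let ?M = "max 1 (v (of_nat b))"
  show ?thesis
  proof (rule le_if_power_le_linear_mult_power)
    fix n
    have M: "?M powr (real n * log b a) = (?M powr log b a) ^ n"
      by (rule powr_power[symmetric]) simp
    have log: "log b (real (a ^ n)) = real n * log b a"
      using a by (simp add: log_nat_power)
    have "v (of_nat a) ^ n = v (of_nat (a ^ n))"
      by (simp add: power)
    also have "\<dots> \<le> real b * (log b (real (a ^ n)) + 1) * ?M powr log b (real (a ^ n))"
      using a b by (intro of_nat_le_base_expansion) auto
    also have "\<dots> = (real b + (real b * log b a) * real n) * (?M powr log b a) ^ n"
      unfolding log M by (simp add: algebra_simps)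
    finally show "v (of_nat a) ^ n \<le> (real b + (real b * log b a) * real n) * (?M powr log b a) ^ n" .
  qed auto
qed

text \<open>The key inequality may be used with \<open>a\<close> and \<open>b\<close> exchanged,
  which makes \<open>ln (v a) / ln a\<close> the same number for all \<open>a\<close> from 2 on;
  that number is the exponent.\<close>

lemma archimedean_of_nat:
  assumes "\<not> ultrametric v"
  obtains c where "0 < c" and "\<And>n. v (of_nat n) = real n powr c"
proof -
  obtain N where N: "1 < v (of_nat N)"
    using assms ultrametric_if_of_nat_le_one by (metis not_le)
  \<comment> \<open>A single base \<open>b\<close> of value at most 1 would bound the value of every
    natural number by 1, that of \<open>N\<close> included.\<close>
  have gt_1: "1 < v (of_nat b)" if "2 \<le> b" for b
  proof (rule ccontr)
    assume "\<not> 1 < v (of_nat b)"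
    moreover have "1 \<le> N"
      using N by (cases N) auto
    ultimately show False
      using of_nat_le_powr_log[OF that, of N] N by (simp add: max_absorb1)
  qed
  have le: "ln (v (of_nat a)) / ln a \<le> ln (v (of_nat b)) / ln b" if ab: "2 \<le> a" "2 \<le> b" for a b
  proof -
    have "v (of_nat a) \<le> v (of_nat b) powr (ln a / ln b)"
      using of_nat_le_powr_log[of b a] ab gt_1[of b] by (simp add: log_def max_def)
    then have "ln (v (of_nat a)) \<le> ln (v (of_nat b) powr (ln a / ln b))"
      using ab gt_1[OF ab(1)] gt_1[OF ab(2)] by (subst ln_le_cancel_iff) auto
    then show ?thesis
      using ab gt_1[OF ab(2)] by (simp add: ln_powr divide_simps) (simp add: mult.commute)
  qed
  define c where "c = ln (v (of_nat 2)) / ln 2"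
  have "0 < c"
    using gt_1[of 2] by (simp add: c_def)
  moreover have "v (of_nat n) = real n powr c" for n
  proof (cases "2 \<le> n")
    case True
    have "ln (v (of_nat n)) / ln n = c"
      using le[OF True, of 2] le[of 2 n] True by (simp add: c_def)
    then have "ln (v (of_nat n)) = c * ln n"
      using True by (simp add: field_simps)
    then show ?thesis
      using gt_1[OF True] True exp_ln[of "v (of_nat n)"] by (simp add: powr_def)
  next
    case False
    then have "n = 0 \<or> n = 1"
      by auto
    then show ?thesis
      by auto
  qed
  ultimately show thesis
    using that by blast
qed

lemma of_rat_archimedean_le_iff:
  assumes "\<not> ultrametric v"
  shows "v (of_rat x) \<le> v (of_rat y) \<longleftrightarrow> \<bar>x\<bar> \<le> \<bar>y\<bar>"
proof -
  obtain c where c: "0 < c" "\<And>n. v (of_nat n) = real n powr c"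
    using archimedean_of_nat[OF assms] by blast
  have v_of_int: "v (of_int a) = \<bar>real_of_int a\<bar> powr c" for a
    unfolding of_int_eq_of_nat c(2) by simp
  have v_of_rat: "v (of_rat z) = \<bar>real_of_rat z\<bar> powr c" for z
    by (cases z) (simp add: of_rat_rat divide v_of_int powr_divide)
  have "\<bar>x\<bar> \<le> \<bar>y\<bar> \<longleftrightarrow> \<bar>real_of_rat x\<bar> \<le> \<bar>real_of_rat y\<bar>"
    by (simp add: abs_if of_rat_less_eq flip: of_rat_minus)
  then show ?thesis
    unfolding v_of_rat using \<open>0 < c\<close>
    using powr_mono2[of c "\<bar>real_of_rat x\<bar>" "\<bar>real_of_rat y\<bar>"]
      powr_less_mono2[of c "\<bar>real_of_rat y\<bar>" "\<bar>real_of_rat x\<bar>"] by linarith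
qed

end

context absval
begin

lemma ln_powi: "x \<noteq> 0 \<Longrightarrow> ln (v (x powi m)) = real_of_int m * ln (v x)"
  by (cases m rule: int_cases2)
    (simp_all add: power_int_minus power_int_of_nat power inverse ln_realpow ln_inverse)

lemma ultrametric_add_le: "ultrametric v \<Longrightarrow> v x \<le> B \<Longrightarrow> v y \<le> B \<Longrightarrow> v (x + y) \<le> B"
  unfolding ultrametric_def by (meson max.boundedI order_trans)

lemma ultrametric_sum_le:
  assumes "ultrametric v" and "finite I" and "I \<noteq> {}" and "\<And>i. i \<in> I \<Longrightarrow> v (f i) \<le> B"
  shows "v (sum f I) \<le> B"
  using assms(2-4)
proof (induction I rule: finite_ne_induct)
  case (insert i I)
  then show ?case
    by (simp add: ultrametric_add_le[OF assms(1)])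
qed simp

lemma ultrametric_of_nat_le_one:
  assumes "ultrametric v"
  shows "v (of_nat n) \<le> 1"
proof (induction n)
  case (Suc n)
  then show ?case
    using ultrametric_add_le[OF assms, of 1 1 "of_nat n"] by simp
qed simp

text \<open>A strictly largest term cannot be cancelled: the sum of the others has at most the
  largest of their values.\<close>

lemma ultrametric_sum_nonzero:
  assumes "ultrametric v" and "finite I" and "j \<in> I" and "f j \<noteq> 0"
    and dominant: "\<And>i. i \<in> I - {j} \<Longrightarrow> v (f i) < v (f j)"
  shows "sum f I \<noteq> 0"
proof (cases "I - {j} = {}")
  case True
  then have "I = {j}"
    using assms by auto
  then show ?thesis
    using assms by simp
next
  case False
  show ?thesis
  proof
    assume "sum f I = 0"
    then have "f j = - sum f (I - {j})"
      using assms by (simp add: sum.remove eq_neg_iff_add_eq_0)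
    then have "v (f j) = v (sum f (I - {j}))"
      by simp
    also have "\<dots> \<le> Max ((\<lambda>i. v (f i)) ` (I - {j}))"
      using assms False by (intro ultrametric_sum_le) auto
    also have "\<dots> < v (f j)"
      using assms False by (subst Max_less_iff) auto
    finally show False
      by simp
  qed
qed

end

section \<open>Places and their representatives\<close>

lemma equiv_absolute_value: "equiv nontrivial_absolute_values absolute_value_equiv"
proof (rule equivI)
  show "absolute_value_equiv \<subseteq> nontrivial_absolute_values \<times> nontrivial_absolute_values"
    by (auto simp: absolute_value_equiv_def)
  show "refl_on nontrivial_absolute_values (absolute_value_equiv :: (('a \<Rightarrow> real) \<times> _) set)"
  proof (rule refl_onI)
    fix v :: "'a \<Rightarrow> real"
    assume "v \<in> nontrivial_absolute_values"
    moreover from this have "v x = v x powr 1" for x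
      by (simp add: nontrivial_absolute_values_def absolute_value_def)
    ultimately show "(v, v) \<in> absolute_value_equiv"
      unfolding absolute_value_equiv_def by (auto intro!: exI[of _ 1])
  qed
  show "sym (absolute_value_equiv :: (('a \<Rightarrow> real) \<times> _) set)"
  proof (rule symI)
    fix v w :: "'a \<Rightarrow> real"
    assume "(v, w) \<in> absolute_value_equiv"
    then obtain c where c: "0 < c" "\<And>x. w x = v x powr c"
      and vw: "v \<in> nontrivial_absolute_values" "w \<in> nontrivial_absolute_values"
      by (auto simp: absolute_value_equiv_def)
    have "v x = w x powr (1 / c)" for x
      using c vw by (simp add: powr_powr nontrivial_absolute_values_def absolute_value_def)
    then show "(w, v) \<in> absolute_value_equiv"
      using c(1) vw unfolding absolute_value_equiv_def by (auto intro!: exI[of _ "1 / c"])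
  qed
  show "trans (absolute_value_equiv :: (('a \<Rightarrow> real) \<times> _) set)"
  proof (rule transI)
    fix u v w :: "'a \<Rightarrow> real"
    assume "(u, v) \<in> absolute_value_equiv" "(v, w) \<in> absolute_value_equiv"
    then obtain c d where "0 < c" "0 < d" "\<And>x. w x = u x powr (c * d)"
      by (auto simp: absolute_value_equiv_def powr_powr)
    then have "\<exists>e>0. \<forall>x. w x = u x powr e"
      by (intro exI[of _ "c * d"]) simp
    then show "(u, w) \<in> absolute_value_equiv"
      using \<open>(u, v) \<in> _\<close> \<open>(v, w) \<in> _\<close> by (auto simp: absolute_value_equiv_def)
  qed
qed

lemma placeD:
  fixes v :: "'a::field_char_0 \<Rightarrow> real"
  assumes "P \<in> places" and "v \<in> P"
  shows "v \<in> nontrivial_absolute_values" and "absval v"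
  using assms in_quotient_imp_subset[OF equiv_absolute_value, of P]
  by (auto simp: places_def nontrivial_absolute_values_def absval_def)

lemma place_nonempty: "P \<in> places \<Longrightarrow> \<exists>v. v \<in> P"
  using in_quotient_imp_non_empty[OF equiv_absolute_value] by (auto simp: places_def)

lemma place_eqI:
  "P \<in> places \<Longrightarrow> Q \<in> places \<Longrightarrow> v \<in> P \<Longrightarrow> w \<in> Q \<Longrightarrow> (v, w) \<in> absolute_value_equiv \<Longrightarrow> P = Q"
  unfolding places_def by (rule quotient_eqI[OF equiv_absolute_value])

lemma place_equiv: "P \<in> places \<Longrightarrow> v \<in> P \<Longrightarrow> w \<in> P \<Longrightarrow> (v, w) \<in> absolute_value_equiv"
  unfolding places_def by (rule in_quotient_imp_in_rel[OF equiv_absolute_value]) auto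

lemma place_powrE:
  assumes "P \<in> places" "v \<in> P" "w \<in> P"
  obtains c where "0 < c" and "\<And>x. w x = v x powr c"
  using place_equiv[OF assms] by (auto simp: absolute_value_equiv_def)

lemma ultrametric_place:
  fixes v :: "'a::field_char_0 \<Rightarrow> real"
  assumes "P \<in> places" "v \<in> P" "w \<in> P" and "ultrametric v"
  shows "ultrametric w"
proof -
  obtain c where c: "0 < c" "\<And>x. w x = v x powr c"
    using place_powrE[OF assms(1-3)] by blast
  interpret absval v
    using placeD assms by blast
  show ?thesis
    unfolding ultrametric_def
  proof (intro allI)
    fix x y
    have "v (x + y) \<le> v x \<or> v (x + y) \<le> v y"
      using \<open>ultrametric v\<close> by (auto simp: ultrametric_def le_max_iff_disj)
    then show "w (x + y) \<le> max (w x) (w y)"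
      using c by (auto simp: le_max_iff_disj intro: powr_mono2)
  qed
qed

text \<open>Not being archimedean provides only one ultrametric representative; the others are
  positive powers of it.\<close>

lemma ultrametric_if_nonarchimedean_place:
  fixes v :: "'a::field_char_0 \<Rightarrow> real"
  assumes "P \<in> places - archimedean_places" and "v \<in> P"
  shows "ultrametric v"
proof -
  obtain w where "w \<in> P" "ultrametric w"
    using assms by (auto simp: archimedean_places_def ultrametric_def)
  then show ?thesis
    using ultrametric_place assms by blast
qed

section \<open>Weak approximation\<close>

text \<open>
  The exponent is pinned down by rational approximation: \<open>v (x ^ n / y ^ m) < 1\<close> compares
  \<open>ln (v x) / ln (v y)\<close> with \<open>m / n\<close>.
\<close>

lemma absolute_value_equiv_if_less_one_imp:
  assumes v: "v \<in> nontrivial_absolute_values" and w: "w \<in> nontrivial_absolute_values"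
    and imp: "\<And>x::'a::field_char_0. v x < 1 \<Longrightarrow> w x < 1"
  shows "(v, w) \<in> absolute_value_equiv"
proof -
  interpret v: absval v
    using v by (simp add: nontrivial_absolute_values_def absval_def)
  interpret w: absval w
    using w by (simp add: nontrivial_absolute_values_def absval_def)
  have imp': "1 < w x" if "1 < v x" for x
  proof -
    have "x \<noteq> 0"
      using that by auto
    then show ?thesis
      using imp[of "inverse x"] that by (simp add: v.inverse w.inverse inverse_less_1_iff)
  qed
  obtain y where y: "1 < v y"
  proof -
    obtain x where "x \<noteq> 0" "v x \<noteq> 1"
      using v by (auto simp: nontrivial_absolute_values_def)
    then have "1 < v x \<or> 1 < v (inverse x)"
      by (auto simp: v.inverse one_less_inverse_iff)
    then show thesis
      using that by blast
  qed
  note wy = imp'[OF y]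
  define c where "c = ln (w y) / ln (v y)"
  have "0 < c"
    unfolding c_def using y wy by (intro divide_pos_pos ln_gt_zero)
  moreover have "w x = v x powr c" for x
  proof (cases "x = 0")
    case False
    define s t where "s = ln (v x) / ln (v y)" and "t = ln (w x) / ln (w y)"
    have "y \<noteq> 0"
      using y by auto
    have s_cmp: "(s < of_rat q \<longrightarrow> t < of_rat q) \<and> (of_rat q < s \<longrightarrow> of_rat q < t)" for q
    proof (cases q)
      case (Fract m n)
      then have n: "0 < n"
        by simp
      define z where "z = x powi n / y powi m"
      have "z \<noteq> 0"
        using \<open>x \<noteq> 0\<close> \<open>y \<noteq> 0\<close> by (simp add: z_def)
      have v_z: "ln (v z) = n * ln (v x) - m * ln (v y)" and w_z: "ln (w z) = n * ln (w x) - m * ln (w y)"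
        using \<open>x \<noteq> 0\<close> \<open>y \<noteq> 0\<close>
        by (simp_all add: z_def v.divide w.divide ln_div v.ln_powi w.ln_powi)
      have q: "of_rat q = real_of_int m / real_of_int n"
        using Fract by (simp add: of_rat_rat)
      have n': "0 < real_of_int n"
        using n by simp
      have cmp: "X / L < of_rat q \<longleftrightarrow> n * X - m * L < 0" "of_rat q < X / L \<longleftrightarrow> 0 < n * X - m * L"
        if "0 < L" for X L :: real
        unfolding q pos_divide_less_eq[OF that] pos_less_divide_eq[OF that] times_divide_eq_left
          pos_divide_less_eq[OF n'] pos_less_divide_eq[OF n']
        by (auto simp: mult.commute)
      have "s < of_rat q \<longleftrightarrow> v z < 1" "of_rat q < s \<longleftrightarrow> 1 < v z"
        unfolding s_def cmp[OF ln_gt_zero[OF y]] v_z[symmetric] using \<open>z \<noteq> 0\<close> by simp_all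
      moreover have "t < of_rat q \<longleftrightarrow> w z < 1" "of_rat q < t \<longleftrightarrow> 1 < w z"
        unfolding t_def cmp[OF ln_gt_zero[OF wy]] w_z[symmetric] using \<open>z \<noteq> 0\<close> by simp_all
      ultimately show ?thesis
        using imp imp' by blast
    qed
    have "s = t"
    proof (rule ccontr)
      assume "s \<noteq> t"
      then consider "s < t" | "t < s"
        by linarith
      then show False
      proof cases
        case 1
        then obtain q where "s < of_rat q" "of_rat q < t"
          using of_rat_dense by blast
        then show False
          using s_cmp[of q] by linarith
      next
        case 2
        then obtain q where "t < of_rat q" "of_rat q < s"
          using of_rat_dense by blast
        then show False
          using s_cmp[of q] by linarith
      qed
    qed
    moreover have "0 < ln (w y)"
      using wy by (rule ln_gt_zero)
    ultimately have "ln (w x) = c * ln (v x)"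
      unfolding s_def t_def c_def by (metis mult.commute nonzero_eq_divide_eq less_irrefl times_divide_eq_left)
    moreover have "exp (ln (w x)) = w x"
      using \<open>x \<noteq> 0\<close> by (intro exp_ln) simp
    ultimately show ?thesis
      using \<open>x \<noteq> 0\<close> by (simp add: powr_def)
  qed simp
  ultimately show ?thesis
    using v w by (auto simp: absolute_value_equiv_def)
qed

text \<open>The equivalence fails in both directions, so there are \<open>a\<close> with
  \<open>v a < 1 \<le> w a\<close> and \<open>b\<close> with \<open>w b < 1 \<le> v b\<close>; their
  quotient separates strictly.\<close>

lemma inequivalent_separation:
  fixes v w :: "'a::field_char_0 \<Rightarrow> real"
  assumes v: "v \<in> nontrivial_absolute_values" and w: "w \<in> nontrivial_absolute_values"
    and neq: "(v, w) \<notin> absolute_value_equiv"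
  obtains x where "1 < v x" and "w x < 1"
proof -
  interpret v: absval v
    using v by (simp add: nontrivial_absolute_values_def absval_def)
  interpret w: absval w
    using w by (simp add: nontrivial_absolute_values_def absval_def)
  obtain a where a: "v a < 1" "1 \<le> w a"
    using absolute_value_equiv_if_less_one_imp[OF v w] neq not_less by blast
  have "(w, v) \<notin> absolute_value_equiv"
    using neq equiv_absolute_value by (meson equivE symD)
  then obtain b where b: "w b < 1" "1 \<le> v b"
    using absolute_value_equiv_if_less_one_imp[OF w v] not_less by blast
  have nz: "a \<noteq> 0"
    using a by auto
  then have "v a > 0" "w a > 0"
    by auto
  then have "1 < v (b / a)" "w (b / a) < 1"
    using a b by (simp_all add: v.divide w.divide field_simps)
  then show thesis
    using that by blast
qed

text \<open>The quotient \<open>a ^ N / (1 + a ^ N)\<close> acts as a switch, tending to 0 where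
  \<open>a\<close> is small and to 1 where \<open>a\<close> is large.\<close>

lemma (in absval) power_div_one_plus_power_tendsto:
  assumes "v a \<noteq> 1"
  shows "(\<lambda>N. v (b * (a ^ N / (1 + a ^ N)))) \<longlonglongrightarrow> (if v a < 1 then 0 else v b)"
proof (cases "v a < 1")
  case True
  have lim: "(\<lambda>N. v a ^ N) \<longlonglongrightarrow> 0"
    using True by (intro LIMSEQ_realpow_zero) auto
  have "\<bar>v (1 + a ^ N) - 1\<bar> \<le> v a ^ N" for N
    using triangle[of 1 "a ^ N"] diff_le[of "1 + a ^ N" "a ^ N"] by (simp add: power)
  then have "(\<lambda>N. v (1 + a ^ N) - 1) \<longlonglongrightarrow> 0"
    by (intro tendsto_rabs_zero_cancel[OF tendsto_sandwich[OF _ _ tendsto_const lim]]) auto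
  then have "(\<lambda>N. v (1 + a ^ N)) \<longlonglongrightarrow> 1"
    by (simp add: LIM_zero_iff)
  from tendsto_mult[OF tendsto_const[of "v b"] tendsto_divide[OF lim this]] show ?thesis
    using True by (simp add: mult divide power)
next
  case False
  then have "1 < v a"
    using assms by simp
  then have "a \<noteq> 0"
    by auto
  have lim: "(\<lambda>N. v (inverse a) ^ N) \<longlonglongrightarrow> 0"
    using \<open>1 < v a\<close> by (intro LIMSEQ_realpow_zero) (auto simp: inverse inverse_less_1_iff)
  have "\<bar>v (1 + inverse a ^ N) - 1\<bar> \<le> v (inverse a) ^ N" for N
    using triangle[of 1 "inverse a ^ N"] diff_le[of "1 + inverse a ^ N" "inverse a ^ N"]
    by (simp add: power)
  then have "(\<lambda>N. v (1 + inverse a ^ N) - 1) \<longlonglongrightarrow> 0"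
    by (intro tendsto_rabs_zero_cancel[OF tendsto_sandwich[OF _ _ tendsto_const lim]]) auto
  then have "(\<lambda>N. v (1 + inverse a ^ N)) \<longlonglongrightarrow> 1"
    by (simp add: LIM_zero_iff)
  moreover have "a ^ N / (1 + a ^ N) = 1 / (1 + inverse a ^ N)" for N
  proof -
    have "1 + inverse a ^ N = (1 + a ^ N) / a ^ N"
      using \<open>a \<noteq> 0\<close> by (simp add: field_simps)
    then show ?thesis
      by simp
  qed
  ultimately have "(\<lambda>N. v b * (1 / v (1 + inverse a ^ N))) \<longlonglongrightarrow> v b * (1 / 1)"
    by (intro tendsto_intros) auto
  then show ?thesis
    using False \<open>\<And>N. a ^ N / (1 + a ^ N) = _\<close> by (simp add: mult divide)
qed

text \<open>
  Weak approximation of Artin and Whaples. To separate \<open>v\<close> also from \<open>w\<close>, let \<open>a\<close> do the job for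
  the earlier absolute values and let \<open>b\<close> separate \<open>v\<close> from \<open>w\<close>; then use \<open>b a ^ N\<close> if \<open>w a \<le> 1\<close>
  and \<open>b a ^ N / (1 + a ^ N)\<close> otherwise.
\<close>

lemma weak_approximation:
  fixes v :: "'a::field_char_0 \<Rightarrow> real"
  assumes "finite W" and v: "v \<in> nontrivial_absolute_values"
    and "W \<subseteq> nontrivial_absolute_values" and "\<And>w. w \<in> W \<Longrightarrow> (v, w) \<notin> absolute_value_equiv"
  shows "\<exists>x. 1 < v x \<and> (\<forall>w\<in>W. w x < 1)"
  using assms(1,3,4)
proof (induction W rule: finite_induct)
  case empty
  interpret absval v
    using v by (simp add: nontrivial_absolute_values_def absval_def)
  obtain x where "x \<noteq> 0" "v x \<noteq> 1"
    using v by (auto simp: nontrivial_absolute_values_def)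
  then have "1 < v x \<or> 1 < v (Fields.inverse x)"
    by (auto simp: inverse one_less_inverse_iff)
  then show ?case
    by auto
next
  case (insert w W)
  interpret v: absval v
    using v by (simp add: nontrivial_absolute_values_def absval_def)
  interpret w: absval w
    using insert.prems by (simp add: nontrivial_absolute_values_def absval_def)
  obtain a where a: "1 < v a" "\<forall>u\<in>W. u a < 1"
    using insert by auto
  obtain b where b: "1 < v b" "w b < 1"
    using inequivalent_separation[OF v, of w] insert.prems by auto
  have absval_W: "absval u" if "u \<in> W" for u
    using insert.prems(1) that by (auto simp: nontrivial_absolute_values_def absval_def)
  show ?case
  proof (cases "w a \<le> 1")
    case True
    have "\<forall>u\<in>W. \<forall>\<^sub>F N in sequentially. u (b * a ^ N) < 1"
    proof
      fix u assume "u \<in> W"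
      interpret u: absval u
        using absval_W \<open>u \<in> W\<close> by blast
      have "(\<lambda>N. u b * u a ^ N) \<longlonglongrightarrow> u b * 0"
        using a \<open>u \<in> W\<close> by (intro tendsto_intros LIMSEQ_realpow_zero) auto
      then show "\<forall>\<^sub>F N in sequentially. u (b * a ^ N) < 1"
        by (intro order_tendstoD(2)[where y = 0]) (simp_all add: u.mult u.power)
    qed
    then have "\<forall>\<^sub>F N in sequentially. \<forall>u\<in>W. u (b * a ^ N) < 1"
      using \<open>finite W\<close> by (simp add: eventually_ball_finite)
    then obtain N where N: "\<forall>u\<in>W. u (b * a ^ N) < 1"
      by (auto simp: eventually_sequentially)
    moreover have "1 < v (b * a ^ N)"
      unfolding v.mult v.power using b(1) a(1) one_le_power[of "v a" N]
      by (intro less_1_mult') auto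
    moreover have "w (b * a ^ N) < 1"
      unfolding w.mult w.power using b(2) power_le_one[of "w a" N] True
        mult_left_le[of "w a ^ N" "w b"] by simp
    ultimately show ?thesis
      by blast
  next
    case False
    define f where "f N = b * (a ^ N / (1 + a ^ N))" for N
    have "\<forall>u\<in>insert w W. \<forall>\<^sub>F N in sequentially. u (f N) < 1"
    proof
      fix u assume "u \<in> insert w W"
      then interpret u: absval u
        using absval_W w.absval_axioms by blast
      have "u a \<noteq> 1"
        using \<open>u \<in> insert w W\<close> a(2) False by auto
      then have "(\<lambda>N. u (f N)) \<longlonglongrightarrow> (if u a < 1 then 0 else u b)"
        unfolding f_def by (rule u.power_div_one_plus_power_tendsto)
      then show "\<forall>\<^sub>F N in sequentially. u (f N) < 1"
        by (rule order_tendstoD) (use \<open>u \<in> insert w W\<close> a(2) b(2) in auto)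
    qed
    then have "\<forall>\<^sub>F N in sequentially. \<forall>u\<in>insert w W. u (f N) < 1"
      by (rule eventually_ball_finite[rotated]) (use \<open>finite W\<close> in simp)
    moreover have "(\<lambda>N. v (f N)) \<longlonglongrightarrow> v b"
      using v.power_div_one_plus_power_tendsto[of a b] a(1) by (simp add: f_def)
    then have "\<forall>\<^sub>F N in sequentially. 1 < v (f N)"
      by (rule order_tendstoD) (rule b(1))
    ultimately have "\<forall>\<^sub>F N in sequentially. (\<forall>u\<in>insert w W. u (f N) < 1) \<and> 1 < v (f N)"
      by (rule eventually_conj)
    then show ?thesis
      by (auto simp: eventually_sequentially)
  qed
qed

section \<open>Finiteness of sets of places\<close>

text \<open>This is the form in which finite dimension enters all finiteness arguments;
  \<open>d\<close> is the degree of the field.\<close>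

lemma number_field_dependent:
  assumes "number_field TYPE('a::field_char_0)"
  shows "\<exists>d. \<forall>Y::'a set. finite Y \<longrightarrow> d < card Y \<longrightarrow>
    (\<exists>c. (\<exists>y\<in>Y. c y \<noteq> 0) \<and> (\<Sum>y\<in>Y. of_rat (c y) * y) = 0)"
proof -
  obtain B where "finite_dimensional_vector_space (\<lambda>(q::rat) (x::'a). of_rat q * x) B"
    using assms by (auto simp: number_field_def)
  then interpret finite_dimensional_vector_space "\<lambda>(q::rat) (x::'a). of_rat q * x" B .
  have "\<exists>c. (\<exists>y\<in>Y. c y \<noteq> 0) \<and> (\<Sum>y\<in>Y. of_rat (c y) * y) = 0"
    if "finite Y" "card B < card Y" for Y :: "'a set"
  proof -
    have "dependent Y"
      using independent_span_bound[OF finite_Basis, of Y] that span_Basis by auto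
    then show ?thesis
      using dependent_finite[OF \<open>finite Y\<close>] by auto
  qed
  then show ?thesis
    by blast
qed

text \<open>The order is recorded instead of the restriction to the rationals because it is the same
  for all representatives of a place and still tells which coefficient of a rational relation is
  largest.\<close>

definition rat_order :: "('a::field_char_0 \<Rightarrow> real) \<Rightarrow> rat rel" where
  "rat_order v = {(p, q). v (of_rat p) \<le> v (of_rat q)}"

text \<open>
  Weak approximation yields, for finitely many places inducing the same order on the rationals,
  elements \<open>y P\<close> that are large at \<open>P\<close> and small at the other places. In a rational linear relation
  between them, the term whose coefficient is largest cannot be cancelled.
\<close>

lemma finite_places_with_rat_order:
  assumes "number_field TYPE('a::field_char_0)"
  shows "finite {P \<in> places. \<exists>v::'a \<Rightarrow> real. v \<in> P \<and> rat_order v = r}" (is "finite ?A")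
proof -
  obtain d where d: "\<And>Y::'a set. finite Y \<Longrightarrow> d < card Y \<Longrightarrow>
      \<exists>c. (\<exists>y\<in>Y. c y \<noteq> 0) \<and> (\<Sum>y\<in>Y. of_rat (c y) * y) = 0"
    using number_field_dependent[OF assms] by blast
  have "card T \<le> d" if T: "finite T" "T \<subseteq> ?A" for T
  proof (rule ccontr)
    assume "\<not> card T \<le> d"
    have "\<forall>P\<in>T. \<exists>v. v \<in> P \<and> rat_order v = r"
      using T by auto
    then obtain v where v: "\<And>P. P \<in> T \<Longrightarrow> v P \<in> P" "\<And>P. P \<in> T \<Longrightarrow> rat_order (v P) = r"
      by metis
    have places: "P \<in> places" if "P \<in> T" for P
      using T that by auto
    have nontrivial: "v P \<in> nontrivial_absolute_values" and absval: "absval (v P)" if "P \<in> T" for P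
      using placeD[OF places[OF that] v(1)[OF that]] by auto
    have "\<exists>x. 1 < v P x \<and> (\<forall>w\<in>v ` (T - {P}). w x < 1)" if "P \<in> T" for P
    proof (rule weak_approximation)
      show "(v P, w) \<notin> absolute_value_equiv" if "w \<in> v ` (T - {P})" for w
      proof -
        obtain Q where "Q \<in> T" "Q \<noteq> P" "w = v Q"
          using \<open>w \<in> _\<close> by blast
        then show ?thesis
          using place_eqI[OF places[OF \<open>P \<in> T\<close>] places[OF \<open>Q \<in> T\<close>] v(1)[OF \<open>P \<in> T\<close>] v(1)[OF \<open>Q \<in> T\<close>]]
          by blast
      qed
    qed (use T that nontrivial in auto)
    then obtain x where x: "\<And>P. P \<in> T \<Longrightarrow> 1 < v P (x P)"
      "\<And>P Q. P \<in> T \<Longrightarrow> Q \<in> T \<Longrightarrow> P \<noteq> Q \<Longrightarrow> v Q (x P) < 1"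
      by (metis DiffI imageI singletonD)
    \<comment> \<open>The other \<open>card T - 1\<close> terms, each below this fraction of the
      dominant coefficient, then cannot add up to it.\<close>
    define \<epsilon> where "\<epsilon> = 1 / real (card T)"
    have "0 < card T"
      using \<open>\<not> card T \<le> d\<close> by simp
    then have "0 < \<epsilon>" "\<epsilon> \<le> 1"
      by (simp_all add: \<epsilon>_def)
    have "\<forall>P\<in>T. \<forall>Q\<in>T. P \<noteq> Q \<longrightarrow> (\<forall>\<^sub>F N in sequentially. v Q (x P) ^ N < \<epsilon>)"
    proof (intro ballI impI)
      fix P Q assume "P \<in> T" "Q \<in> T" "P \<noteq> Q"
      interpret absval "v Q"
        using absval \<open>Q \<in> T\<close> by blast
      have "(\<lambda>N. v Q (x P) ^ N) \<longlonglongrightarrow> 0"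
        using x(2)[OF \<open>P \<in> T\<close> \<open>Q \<in> T\<close> \<open>P \<noteq> Q\<close>] by (intro LIMSEQ_realpow_zero) auto
      then show "\<forall>\<^sub>F N in sequentially. v Q (x P) ^ N < \<epsilon>"
        using \<open>0 < \<epsilon>\<close> by (rule order_tendstoD)
    qed
    then have "\<forall>\<^sub>F N in sequentially. \<forall>P\<in>T. \<forall>Q\<in>T. P \<noteq> Q \<longrightarrow> v Q (x P) ^ N < \<epsilon>"
      using \<open>finite T\<close> by (intro eventually_ball_finite ballI) (auto elim: eventually_mono)
    from eventually_happens'[OF sequentially_bot this]
    obtain N where N: "\<And>P Q. P \<in> T \<Longrightarrow> Q \<in> T \<Longrightarrow> P \<noteq> Q \<Longrightarrow> v Q (x P) ^ N < \<epsilon>"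
      by blast
    define y where "y P = x P ^ N" for P
    have large: "1 \<le> v P (y P)" if "P \<in> T" for P
      using absval.power[OF absval[OF that]] x(1)[OF that] by (simp add: y_def one_le_power)
    have small: "v Q (y P) < \<epsilon>" if "P \<in> T" "Q \<in> T" "P \<noteq> Q" for P Q
      using absval.power[OF absval[OF that(2)]] N[OF that] by (simp add: y_def)
    have inj: "inj_on y T"
    proof (rule inj_onI, rule ccontr)
      fix P Q assume "P \<in> T" "Q \<in> T" "y P = y Q" "P \<noteq> Q"
      then show False
        using large[of Q] small[of P Q] \<open>\<epsilon> \<le> 1\<close> by simp
    qed
    have "d < card (y ` T)"
      using \<open>\<not> card T \<le> d\<close> by (simp add: card_image[OF inj])
    then obtain c' where c': "\<exists>z\<in>y ` T. c' z \<noteq> 0" "(\<Sum>z\<in>y ` T. of_rat (c' z) * z) = 0"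
      using d[of "y ` T"] \<open>finite T\<close> by auto
    define c where "c P = c' (y P)" for P
    have c: "\<exists>P\<in>T. c P \<noteq> 0" "(\<Sum>P\<in>T. of_rat (c P) * y P) = 0"
      using c' by (simp_all add: c_def sum.reindex[OF inj])
    \<comment> \<open>The largest coefficient is selected at an arbitrary place \<open>P0\<close>.
      Since all places of \<open>T\<close> induce the same order on the rationals, it is also
      largest at the place \<open>P\<close> to which it belongs, where \<open>y P\<close> is large
      and the other \<open>y Q\<close> are small.\<close>
    obtain P0 where "P0 \<in> T"
      using \<open>0 < card T\<close> by fastforce
    obtain P where P: "P \<in> T" "\<And>Q. Q \<in> T \<Longrightarrow> v P0 (of_rat (c Q)) \<le> v P0 (of_rat (c P))"
    proof -
      have "Max ((\<lambda>Q. v P0 (of_rat (c Q))) ` T) \<in> (\<lambda>Q. v P0 (of_rat (c Q))) ` T"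
        using \<open>finite T\<close> \<open>P0 \<in> T\<close> by (intro Max_in) auto
      then obtain P where "P \<in> T" "v P0 (of_rat (c P)) = Max ((\<lambda>Q. v P0 (of_rat (c Q))) ` T)"
        by auto
      then show thesis
        using that[of P] \<open>finite T\<close> by simp
    qed
    interpret absval "v P"
      using absval \<open>P \<in> T\<close> by blast
    have dominant: "v P (of_rat (c Q)) \<le> v P (of_rat (c P))" if "Q \<in> T" for Q
    proof -
      have "rat_order (v P) = rat_order (v P0)"
        using v(2) \<open>P \<in> T\<close> \<open>P0 \<in> T\<close> by simp
      then show ?thesis
        using P(2)[OF that] by (auto simp: rat_order_def set_eq_iff)
    qed
    have "c P \<noteq> 0"
    proof
      assume "c P = 0"
      have "c Q = 0" if "Q \<in> T" for Q
      proof -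
        have "v P (of_rat (c Q)) = 0"
          using dominant[OF that] \<open>c P = 0\<close> by (intro antisym) auto
        then show ?thesis
          by simp
      qed
      then show False
        using c(1) by blast
    qed
    have "of_rat (c P) * y P = - (\<Sum>Q\<in>T - {P}. of_rat (c Q) * y Q)"
      using c(2) \<open>P \<in> T\<close> \<open>finite T\<close> by (simp add: sum.remove eq_neg_iff_add_eq_0)
    then have "v P (of_rat (c P)) * v P (y P) = v P (\<Sum>Q\<in>T - {P}. of_rat (c Q) * y Q)"
      by (simp flip: mult)
    also have "\<dots> \<le> (\<Sum>Q\<in>T - {P}. v P (of_rat (c Q)) * v P (y Q))"
      using sum_le[of "\<lambda>Q. of_rat (c Q) * y Q" "T - {P}"] by (simp add: mult)
    also have "\<dots> \<le> (\<Sum>Q\<in>T - {P}. v P (of_rat (c P)) * \<epsilon>)"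
      using dominant small \<open>P \<in> T\<close> by (intro sum_mono mult_mono) (auto intro: less_imp_le)
    also have "\<dots> = v P (of_rat (c P)) * (real (card T - 1) / real (card T))"
      using \<open>P \<in> T\<close> \<open>finite T\<close> by (simp add: \<epsilon>_def)
    also have "\<dots> < v P (of_rat (c P)) * 1"
      using \<open>c P \<noteq> 0\<close> \<open>0 < card T\<close> by (intro mult_strict_left_mono) auto
    also have "\<dots> \<le> v P (of_rat (c P)) * v P (y P)"
      using large[OF \<open>P \<in> T\<close>] by (intro mult_left_mono) auto
    finally show False
      by simp
  qed
  then show ?thesis
    by (meson finite_if_finite_subsets_card_bdd)
qed

lemma finite_archimedean_places:
  assumes "number_field TYPE('a::field_char_0)"
  shows "finite (archimedean_places :: ('a \<Rightarrow> real) set set)"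
proof (rule finite_subset[OF _ finite_places_with_rat_order[OF assms, of "{(p, q). \<bar>p\<bar> \<le> \<bar>q\<bar>}"]])
  show "archimedean_places \<subseteq> {P \<in> places. \<exists>v::'a \<Rightarrow> real. v \<in> P \<and> rat_order v = {(p, q). \<bar>p\<bar> \<le> \<bar>q\<bar>}}"
  proof
    fix P :: "('a \<Rightarrow> real) set"
    assume "P \<in> archimedean_places"
    then have P: "P \<in> places" "\<And>v. v \<in> P \<Longrightarrow> \<not> ultrametric v"
      by (auto simp: archimedean_places_def ultrametric_def)
    then obtain v where "v \<in> P"
      using place_nonempty by blast
    then have "rat_order v = {(p, q). \<bar>p\<bar> \<le> \<bar>q\<bar>}"
      using absval.of_rat_archimedean_le_iff[OF placeD(2)[OF P(1) \<open>v \<in> P\<close>] P(2)[OF \<open>v \<in> P\<close>]]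
      by (simp add: rat_order_def)
    then show "P \<in> {P \<in> places. \<exists>v. v \<in> P \<and> rat_order v = {(p, q). \<bar>p\<bar> \<le> \<bar>q\<bar>}}"
      using P \<open>v \<in> P\<close> by blast
  qed
qed

section \<open>Nonarchimedean places and their residue characteristics\<close>

definition residue_characteristic :: "('a::field \<Rightarrow> real) \<Rightarrow> nat \<Rightarrow> bool" where
  "residue_characteristic v p \<longleftrightarrow> 0 < p \<and> v (of_nat p) < 1 \<and> (\<forall>r. 0 < r \<longrightarrow> r < p \<longrightarrow> 1 \<le> v (of_nat r))"

context absval
begin

lemma residue_characteristic_ge_2:
  assumes "residue_characteristic v p"
  shows "2 \<le> p"
proof -
  have "0 < p" "v (of_nat p) < 1"
    using assms by (simp_all add: residue_characteristic_def)
  moreover from this have "p \<noteq> 1"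
    by auto
  ultimately show ?thesis
    by linarith
qed

lemma residue_characteristic_exists:
  assumes "0 < m" and "v (of_nat m) < 1"
  obtains p where "residue_characteristic v p" and "p \<le> m"
proof -
  define p where "p = (LEAST p. 0 < p \<and> v (of_nat p) < 1)"
  have "0 < p \<and> v (of_nat p) < 1"
    unfolding p_def by (rule LeastI[of _ m]) (use assms in auto)
  moreover have "p \<le> r" if "0 < r" "v (of_nat r) < 1" for r
    unfolding p_def by (rule Least_le) (use that in auto)
  ultimately have "residue_characteristic v p" "p \<le> m"
    using assms by (auto simp: residue_characteristic_def not_less[symmetric])
  then show thesis
    using that by blast
qed

text \<open>By minimality of \<open>p\<close> the nonzero remainder of \<open>m\<close> modulo
  \<open>p\<close> has value at least 1, while the multiple of \<open>p\<close> that is split off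
  has value below 1.\<close>

lemma of_nat_eq_one_if_not_dvd:
  assumes "ultrametric v" and p: "residue_characteristic v p" and "\<not> p dvd m"
  shows "v (of_nat m) = 1"
proof -
  have "0 < m mod p" "m mod p < p"
    using assms by (auto simp: residue_characteristic_def mod_greater_zero_iff_not_dvd)
  then have "1 \<le> v (of_nat (m mod p))"
    using p by (auto simp: residue_characteristic_def)
  also have "(of_nat (m mod p) :: 'a) = of_nat m + - (of_nat p * of_nat (m div p))"
    by (simp add: algebra_simps flip: of_nat_mult of_nat_add)
  finally have le: "1 \<le> v (of_nat m + - (of_nat p * of_nat (m div p)))" .
  have "v (of_nat p * of_nat (m div p)) \<le> v (of_nat p) * 1"
    unfolding mult by (intro mult_left_mono ultrametric_of_nat_le_one assms) auto
  also have "\<dots> < 1"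
    using p by (simp add: residue_characteristic_def)
  finally have lt: "v (of_nat p * of_nat (m div p)) < 1" .
  have "v (of_nat m + - (of_nat p * of_nat (m div p)))
      \<le> max (v (of_nat m)) (v (of_nat p * of_nat (m div p)))"
    by (rule ultrametric_add_le) (use assms in auto)
  then have "1 \<le> v (of_nat m)"
    using le lt by (auto simp: le_max_iff_disj)
  then show ?thesis
    using ultrametric_of_nat_le_one[OF \<open>ultrametric v\<close>, of m] by linarith
qed

lemma of_nat_eq_power_multiplicity:
  assumes "ultrametric v" and p: "residue_characteristic v p" and "m \<noteq> 0"
  shows "v (of_nat m) = v (of_nat p) ^ multiplicity p m"
proof -
  have "\<not> is_unit p"
    using residue_characteristic_ge_2[OF p] by simp
  then obtain k where k: "m = p ^ multiplicity p m * k" "\<not> p dvd k"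
    using multiplicity_decompose'[OF \<open>m \<noteq> 0\<close>] by blast
  have "v (of_nat m) = v (of_nat p) ^ multiplicity p m * v (of_nat k)"
    by (subst k(1)) (simp add: mult power)
  then show ?thesis
    using of_nat_eq_one_if_not_dvd[OF assms(1) p k(2)] by simp
qed

text \<open>The right-hand side involves \<open>v\<close> only through \<open>p\<close>, so the
  residue characteristic determines the order on the rationals.\<close>

lemma of_nat_le_iff_multiplicity:
  assumes "ultrametric v" and p: "residue_characteristic v p"
  shows "v (of_nat i) \<le> v (of_nat j) \<longleftrightarrow> i = 0 \<or> j \<noteq> 0 \<and> multiplicity p j \<le> multiplicity p i"
proof (cases "i = 0 \<or> j = 0")
  case True
  then show ?thesis
    by auto
next
  case False
  have "0 < v (of_nat p)" "v (of_nat p) < 1"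
    using p by (auto simp: residue_characteristic_def)
  then show ?thesis
    using False by (simp add: of_nat_eq_power_multiplicity[OF assms] power_decreasing_iff del: pos_iff)
qed

end

lemma rat_order_eq_if_residue_characteristic:
  assumes "absval v" "ultrametric v" "residue_characteristic v p"
    and "absval w" "ultrametric w" "residue_characteristic w p"
  shows "rat_order v = rat_order w"
proof -
  interpret v: absval v
    by fact
  interpret w: absval w
    by fact
  have nat: "v (of_nat i) \<le> v (of_nat j) \<longleftrightarrow> w (of_nat i) \<le> w (of_nat j)" for i j
    using v.of_nat_le_iff_multiplicity[OF assms(2,3)] w.of_nat_le_iff_multiplicity[OF assms(5,6)]
    by simp
  have "v (of_rat x) \<le> v (of_rat y) \<longleftrightarrow> w (of_rat x) \<le> w (of_rat y)" for x y
  proof (cases x)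
    case x: (Fract a b)
    show ?thesis
    proof (cases y)
      case y: (Fract c d)
      have cross: "u (of_rat x) \<le> u (of_rat y) \<longleftrightarrow>
          u (of_nat (nat \<bar>a * d\<bar>)) \<le> u (of_nat (nat \<bar>c * b\<bar>))" if "absval u" for u :: "'c::field_char_0 \<Rightarrow> real"
      proof -
        interpret u: absval u
          by fact
        have pos: "0 < u (of_int b)" "0 < u (of_int d)"
          using x y by auto
        have "u (of_rat x) = u (of_int a) / u (of_int b)" "u (of_rat y) = u (of_int c) / u (of_int d)"
          using x y by (simp_all add: of_rat_rat u.divide)
        then have "u (of_rat x) \<le> u (of_rat y) \<longleftrightarrow> u (of_int (a * d)) \<le> u (of_int (c * b))"
          by (simp only: pos_divide_le_eq[OF pos(1)] times_divide_eq_left pos_le_divide_eq[OF pos(2)]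
              of_int_mult u.mult)
        then show ?thesis
          by (simp only: u.of_int_eq_of_nat)
      qed
      show ?thesis
        unfolding cross[OF assms(1)] cross[OF assms(4)] by (rule nat)
    qed
  qed
  then show ?thesis
    by (auto simp: rat_order_def)
qed

text \<open>The residue characteristic of such a place is at most \<open>m\<close>, and the places
  with a given residue characteristic all induce one order.\<close>

lemma finite_nonarchimedean_places_of_nat:
  assumes "number_field TYPE('a::field_char_0)" and "0 < m"
  shows "finite {P \<in> places. \<exists>v::'a \<Rightarrow> real. v \<in> P \<and> ultrametric v \<and> v (of_nat m) < 1}"
proof -
  define A where "A p = {P \<in> places. \<exists>v::'a \<Rightarrow> real. v \<in> P \<and> ultrametric v \<and> residue_characteristic v p}" for p
  have "finite (A p)" for p
  proof (cases "A p = {}")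
    case False
    then obtain P w where w: "P \<in> places" "w \<in> P" "ultrametric w" "residue_characteristic (w :: 'a \<Rightarrow> real) p"
      by (auto simp: A_def)
    have "A p \<subseteq> {P \<in> places. \<exists>v::'a \<Rightarrow> real. v \<in> P \<and> rat_order v = rat_order w}"
      unfolding A_def using rat_order_eq_if_residue_characteristic[OF placeD(2) _ _ placeD(2)[OF w(1,2)] w(3,4)]
      by blast
    then show ?thesis
      by (rule finite_subset) (rule finite_places_with_rat_order[OF assms(1)])
  qed simp
  then have "finite (\<Union>p\<le>m. A p)"
    by blast
  moreover have "{P \<in> places. \<exists>v::'a \<Rightarrow> real. v \<in> P \<and> ultrametric v \<and> v (of_nat m) < 1} \<subseteq> (\<Union>p\<le>m. A p)"
  proof
    fix P assume "P \<in> {P \<in> places. \<exists>v::'a \<Rightarrow> real. v \<in> P \<and> ultrametric v \<and> v (of_nat m) < 1}"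
    then obtain v :: "'a \<Rightarrow> real" where v: "P \<in> places" "v \<in> P" "ultrametric v" "v (of_nat m) < 1"
      by blast
    then obtain p where "residue_characteristic v p" "p \<le> m"
      using absval.residue_characteristic_exists[OF placeD(2) \<open>0 < m\<close>] by blast
    then show "P \<in> (\<Union>p\<le>m. A p)"
      using v by (auto simp: A_def)
  qed
  ultimately show ?thesis
    by (rule finite_subset[rotated])
qed

lemma finite_nonarchimedean_places_of_rat:
  assumes "number_field TYPE('a::field_char_0)" and "q \<noteq> 0"
  shows "finite {P \<in> places. \<exists>v::'a \<Rightarrow> real. v \<in> P \<and> ultrametric v \<and> v (of_rat q) \<noteq> 1}"
proof (cases q)
  case (Fract a b)
  then have ab: "0 < nat \<bar>a\<bar>" "0 < nat \<bar>b\<bar>"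
    using \<open>q \<noteq> 0\<close> by (auto simp: Zero_rat_def eq_rat)
  define A where "A m = {P \<in> places. \<exists>v::'a \<Rightarrow> real. v \<in> P \<and> ultrametric v \<and> v (of_nat m) < 1}" for m
  have "finite (A (nat \<bar>a\<bar>) \<union> A (nat \<bar>b\<bar>))"
    unfolding A_def using finite_nonarchimedean_places_of_nat[OF assms(1)] ab by blast
  moreover have "P \<in> A (nat \<bar>a\<bar>) \<union> A (nat \<bar>b\<bar>)"
    if "P \<in> places" "v \<in> P" "ultrametric v" "v (of_rat q) \<noteq> 1" for P and v :: "'a \<Rightarrow> real"
  proof -
    interpret absval v
      using that(1,2) by (rule placeD(2))
    have "v (of_rat q) = v (of_nat (nat \<bar>a\<bar>)) / v (of_nat (nat \<bar>b\<bar>))"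
      unfolding of_int_eq_of_nat[symmetric] using Fract by (simp add: of_rat_rat divide)
    then have "v (of_nat (nat \<bar>a\<bar>)) \<noteq> 1 \<or> v (of_nat (nat \<bar>b\<bar>)) \<noteq> 1"
      using that(4) by auto
    then have "v (of_nat (nat \<bar>a\<bar>)) < 1 \<or> v (of_nat (nat \<bar>b\<bar>)) < 1"
      using ultrametric_of_nat_le_one[OF that(3)] less_le by blast
    then show ?thesis
      using that by (auto simp only: A_def)
  qed
  ultimately show ?thesis
    by (elim finite_subset[rotated]) blast
qed

text \<open>
  In a rational linear relation between powers of \<open>x\<close> the terms cannot have pairwise distinct
  absolute values, so \<open>v x \<noteq> 1\<close> forces a coefficient \<open>c\<close> with \<open>v c \<noteq> 1\<close>.
\<close>

lemma finite_nonarchimedean_places_ne_one: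
  assumes nf: "number_field TYPE('a::field_char_0)" and "(x::'a) \<noteq> 0"
  shows "finite {P \<in> places. \<exists>v. v \<in> P \<and> ultrametric v \<and> v x \<noteq> 1}"
proof -
  obtain d where d: "\<And>Y::'a set. finite Y \<Longrightarrow> d < card Y \<Longrightarrow>
      \<exists>c. (\<exists>y\<in>Y. c y \<noteq> 0) \<and> (\<Sum>y\<in>Y. of_rat (c y) * y) = 0"
    using number_field_dependent[OF nf] by blast
  show ?thesis
  proof (cases "inj_on (\<lambda>i. x ^ i) {..d}")
    \<comment> \<open>Two equal powers make the nonzero \<open>x\<close> a root of unity, so it has
      value 1 everywhere.\<close>
    case False
    then obtain i j where ij: "i \<noteq> j" "x ^ i = x ^ j"
      unfolding inj_on_def by blast
    have "v x = 1" if "P \<in> places" "v \<in> P" for P v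
    proof -
      interpret absval v
        using that(1,2) by (rule placeD(2))
      have "v x ^ i = v x ^ j"
        using ij by (simp flip: power)
      then show ?thesis
        using \<open>x \<noteq> 0\<close> ij(1) power_inject_exp'[of "v x" i j] by auto
    qed
    then have empty: "{P \<in> places. \<exists>v. v \<in> P \<and> ultrametric v \<and> v x \<noteq> 1} = {}"
      by blast
    show ?thesis
      unfolding empty by (rule finite.emptyI)
  next
    case True
    then have "d < card ((\<lambda>i. x ^ i) ` {..d})"
      by (simp add: card_image)
    with d[of "(\<lambda>i. x ^ i) ` {..d}", OF finite_imageI[OF finite_atMost]]
    obtain c' where c': "\<exists>y\<in>(\<lambda>i. x ^ i) ` {..d}. c' y \<noteq> 0"
        "(\<Sum>y\<in>(\<lambda>i. x ^ i) ` {..d}. of_rat (c' y) * y) = 0"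
      by blast
    define c where "c i = c' (x ^ i)" for i
    define I where "I = {i \<in> {..d}. c i \<noteq> 0}"
    have I: "finite I" "I \<noteq> {}"
      using c'(1) by (auto simp: I_def c_def)
    have "(\<Sum>i\<in>I. of_rat (c i) * x ^ i) = (\<Sum>i\<le>d. of_rat (c i) * x ^ i)"
      by (intro sum.mono_neutral_left) (auto simp: I_def)
    also have "\<dots> = 0"
      using c'(2) by (simp add: c_def sum.reindex[OF True])
    finally have rel: "(\<Sum>i\<in>I. of_rat (c i) * x ^ i) = 0" .
    define A where "A q = {P \<in> places. \<exists>v::'a \<Rightarrow> real. v \<in> P \<and> ultrametric v \<and> v (of_rat q) \<noteq> 1}" for q
    have "finite (\<Union>i\<in>I. A (c i))"
      using I(1) finite_nonarchimedean_places_of_rat[OF nf] by (auto simp: A_def I_def)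
    moreover have "P \<in> (\<Union>i\<in>I. A (c i))"
      if P: "P \<in> places" "v \<in> P" "ultrametric v" "v x \<noteq> 1" for P v
    proof (rule ccontr)
      assume "P \<notin> (\<Union>i\<in>I. A (c i))"
      then have c1: "v (of_rat (c i)) = 1" if "i \<in> I" for i
        using P that by (auto simp: A_def)
      interpret absval v
        using P(1,2) by (rule placeD(2))
      have abs_term: "v (of_rat (c i) * x ^ i) = v x ^ i" if "i \<in> I" for i
        using c1[OF that] by (simp add: mult power)
      have "0 < v x"
        using \<open>x \<noteq> 0\<close> by simp
      have "\<exists>j\<in>I. \<forall>i\<in>I - {j}. v x ^ i < v x ^ j"
      proof (cases "v x < 1")
        case True
        have "v x ^ i < v x ^ Min I" if "i \<in> I - {Min I}" for i
          using True \<open>0 < v x\<close> that Min_le[OF I(1), of i]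
          by (intro power_strict_decreasing) (auto simp: less_le)
        then show ?thesis
          using Min_in[OF I] by blast
      next
        case False
        then have "1 < v x"
          using P by simp
        then have "v x ^ i < v x ^ Max I" if "i \<in> I - {Max I}" for i
          using that Max_ge[OF I(1), of i]
          by (intro power_strict_increasing) (auto simp: less_le)
        then show ?thesis
          using Max_in[OF I] by blast
      qed
      then obtain j where j: "j \<in> I" "\<And>i. i \<in> I - {j} \<Longrightarrow> v x ^ i < v x ^ j"
        by blast
      have "(\<Sum>i\<in>I. of_rat (c i) * x ^ i) \<noteq> 0"
        by (rule ultrametric_sum_nonzero[OF P(3) I(1) j(1)])
          (use j \<open>x \<noteq> 0\<close> abs_term in \<open>auto simp: I_def\<close>)
      then show False
        using rel by simp
    qed
    ultimately show ?thesis
      by (elim finite_subset[rotated]) blast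
  qed
qed

section \<open>Rings of S-integers\<close>

text \<open>The ideal computations are valid over any subring of the field in which certain elements
  are invertible; they can thus be carried out before \<open>S\<close> is chosen.\<close>

locale field_subring =
  fixes R :: "'a::field set"
  assumes zero_mem [simp]: "0 \<in> R"
    and one_mem [simp]: "1 \<in> R"
    and add_mem: "x \<in> R \<Longrightarrow> y \<in> R \<Longrightarrow> x + y \<in> R"
    and minus_mem: "x \<in> R \<Longrightarrow> - x \<in> R"
    and mult_mem: "x \<in> R \<Longrightarrow> y \<in> R \<Longrightarrow> x * y \<in> R"

lemma field_subring_S_integers:
  assumes "archimedean_places \<subseteq> S"
  shows "field_subring (S_integers S :: 'a::field_char_0 set)"
proof -
  have *: "absval v \<and> ultrametric v" if "P \<in> places - S" "v \<in> P" for P and v :: "'a \<Rightarrow> real"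
    using that assms placeD[of P v] ultrametric_if_nonarchimedean_place[of P v] by blast
  show ?thesis
  proof
    show "0 \<in> (S_integers S :: 'a set)" "1 \<in> (S_integers S :: 'a set)"
      using * by (auto simp: S_integers_def absval.zero absval.one)
    fix x y :: 'a
    assume x: "x \<in> S_integers S"
    then show "- x \<in> S_integers S"
      using * by (auto simp: S_integers_def absval.minus)
    assume y: "y \<in> S_integers S"
    show "x + y \<in> S_integers S"
      using * x y by (auto simp: S_integers_def intro: absval.ultrametric_add_le)
    show "x * y \<in> S_integers S"
      unfolding S_integers_def
    proof (intro CollectI ballI)
      fix P v assume P: "P \<in> places - S" "v \<in> P"
      then have "v x \<le> 1" "v y \<le> 1" "absval v"
        using x y * by (auto simp: S_integers_def)
      then show "v (x * y) \<le> 1"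
        by (simp add: absval.mult absval.nonneg mult_le_one)
    qed
  qed
qed

definition is_unit_in :: "'a::field set \<Rightarrow> 'a \<Rightarrow> bool" where
  "is_unit_in R x \<longleftrightarrow> x \<noteq> 0 \<and> x \<in> R \<and> inverse x \<in> R"

lemma S_integers_with_units:
  fixes E :: "'a::field_char_0 set"
  assumes nf: "number_field TYPE('a)" and "finite E" and "0 \<notin> E"
  obtains S :: "('a \<Rightarrow> real) set set" where "finite S" and "archimedean_places \<subseteq> S" and "S \<subseteq> places"
    and "field_subring (S_integers S)" and "\<And>e. e \<in> E \<Longrightarrow> is_unit_in (S_integers S) e"
proof -
  define B where "B e = {P \<in> places. \<exists>v::'a \<Rightarrow> real. v \<in> P \<and> ultrametric v \<and> v e \<noteq> 1}" for e
  define S where "S = archimedean_places \<union> (\<Union>e\<in>E. B e)"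
  have "finite (B e)" if "e \<in> E" for e
    unfolding B_def by (rule finite_nonarchimedean_places_ne_one[OF nf]) (use that \<open>0 \<notin> E\<close> in auto)
  then have "finite S"
    using finite_archimedean_places[OF nf] \<open>finite E\<close> by (simp add: S_def)
  moreover have "S \<subseteq> places"
    by (auto simp: S_def B_def archimedean_places_def)
  moreover have S: "archimedean_places \<subseteq> S"
    by (simp add: S_def)
  moreover have "is_unit_in (S_integers S) e" if "e \<in> E" for e
  proof -
    have le_1: "v e \<le> 1 \<and> v (inverse e) \<le> 1" if P: "P \<in> places - S" "v \<in> P" for P v
    proof -
      interpret absval v
        using P by (intro placeD(2)) auto
      have "ultrametric v"
        using ultrametric_if_nonarchimedean_place[of P v] P S by blast
      then have "v e = 1"
        using P \<open>e \<in> E\<close> by (auto simp: S_def B_def)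
      then show ?thesis
        by (simp add: inverse)
    qed
    have "e \<in> S_integers S" "inverse e \<in> S_integers S"
      unfolding S_integers_def using le_1 by blast+
    then show ?thesis
      using that \<open>0 \<notin> E\<close> by (auto simp: is_unit_in_def)
  qed
  ultimately show thesis
    using that field_subring_S_integers[OF S] by blast
qed

section \<open>Ideals\<close>

context field_subring
begin

text \<open>Submodules of the whole field rather than of \<open>R\<close>, so that fractional ideals
  and the zero ideal are covered.\<close>

definition submodule :: "'a set \<Rightarrow> bool" where
  "submodule M \<longleftrightarrow> 0 \<in> M \<and> (\<forall>x\<in>M. \<forall>y\<in>M. x + y \<in> M) \<and> (\<forall>r\<in>R. \<forall>x\<in>M. r * x \<in> M)"

lemma submodule_zero: "submodule M \<Longrightarrow> 0 \<in> M"
  and submodule_add: "submodule M \<Longrightarrow> x \<in> M \<Longrightarrow> y \<in> M \<Longrightarrow> x + y \<in> M"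
  and submodule_scale: "submodule M \<Longrightarrow> r \<in> R \<Longrightarrow> x \<in> M \<Longrightarrow> r * x \<in> M"
  by (auto simp: submodule_def)

lemma submodule_sum: "submodule M \<Longrightarrow> (\<And>i. i \<in> I \<Longrightarrow> f i \<in> M) \<Longrightarrow> sum f I \<in> M"
  by (induction I rule: infinite_finite_induct) (auto simp: submodule_def)

lemma submodule_ideal_gen: "submodule (ideal_gen R A)"
  unfolding submodule_def
proof (intro conjI ballI)
  show "0 \<in> ideal_gen R A"
    unfolding ideal_gen_def by (intro CollectI exI[of _ "{}"] exI[of _ "\<lambda>_. 0"]) auto
next
  fix x y assume "x \<in> ideal_gen R A" "y \<in> ideal_gen R A"
  then obtain S c T d where
      S: "finite S" "S \<subseteq> A" "c ` S \<subseteq> R" "x = (\<Sum>a\<in>S. c a * a)" and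
      T: "finite T" "T \<subseteq> A" "d ` T \<subseteq> R" "y = (\<Sum>a\<in>T. d a * a)"
    by (auto simp: ideal_gen_def)
  define e where "e a = (if a \<in> S then c a else 0) + (if a \<in> T then d a else 0)" for a
  have "x = (\<Sum>a\<in>S \<union> T. (if a \<in> S then c a else 0) * a)"
    unfolding S(4) using S(1) T(1) by (intro sum.mono_neutral_cong_left) auto
  moreover have "y = (\<Sum>a\<in>S \<union> T. (if a \<in> T then d a else 0) * a)"
    unfolding T(4) using S(1) T(1) by (intro sum.mono_neutral_cong_left) auto
  ultimately have "x + y = (\<Sum>a\<in>S \<union> T. e a * a)"
    by (simp add: e_def distrib_right sum.distrib)
  moreover have "e ` (S \<union> T) \<subseteq> R"
    using S(3) T(3) by (auto simp: e_def image_subset_iff intro!: add_mem)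
  ultimately show "x + y \<in> ideal_gen R A"
    using S T unfolding ideal_gen_def by (intro CollectI exI[of _ "S \<union> T"] exI[of _ e]) auto
next
  fix r x assume "r \<in> R" "x \<in> ideal_gen R A"
  then obtain S c where S: "finite S" "S \<subseteq> A" "c ` S \<subseteq> R" "x = (\<Sum>a\<in>S. c a * a)"
    by (auto simp: ideal_gen_def)
  then show "r * x \<in> ideal_gen R A"
    using \<open>r \<in> R\<close> unfolding ideal_gen_def
    by (intro CollectI exI[of _ S] exI[of _ "\<lambda>a. r * c a"])
      (auto simp: sum_distrib_left mult.assoc intro: mult_mem)
qed

lemma ideal_gen_superset: "a \<in> A \<Longrightarrow> a \<in> ideal_gen R A"
  unfolding ideal_gen_def by (intro CollectI exI[of _ "{a}"] exI[of _ "\<lambda>_. 1"]) auto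

lemma ideal_gen_multiple: "r \<in> R \<Longrightarrow> a \<in> A \<Longrightarrow> r * a \<in> ideal_gen R A"
  by (rule submodule_scale[OF submodule_ideal_gen _ ideal_gen_superset])

text \<open>With \<open>submodule_ideal_gen\<close> and \<open>ideal_gen_superset\<close>, this
  universal property replaces explicit finite sums from here on.\<close>

lemma ideal_gen_least: "submodule M \<Longrightarrow> A \<subseteq> M \<Longrightarrow> ideal_gen R A \<subseteq> M"
  unfolding ideal_gen_def by (auto intro!: submodule_sum submodule_scale)

lemma ideal_gen_subsetI: "A \<subseteq> ideal_gen R B \<Longrightarrow> ideal_gen R A \<subseteq> ideal_gen R B"
  by (rule ideal_gen_least[OF submodule_ideal_gen])

lemma submodule_image_mult: "submodule M \<Longrightarrow> submodule ((*) c ` M)"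
proof -
  assume M: "submodule M"
  have "c * x + c * y \<in> (*) c ` M" if "x \<in> M" "y \<in> M" for x y
    using submodule_add[OF M that] by (metis distrib_left image_eqI)
  moreover have "r * (c * x) \<in> (*) c ` M" if "r \<in> R" "x \<in> M" for r x
    using submodule_scale[OF M that] by (metis mult.left_commute image_eqI)
  moreover have "0 \<in> (*) c ` M"
    using submodule_zero[OF M] by (metis mult_zero_right image_eqI)
  ultimately show ?thesis
    by (auto simp: submodule_def)
qed

lemma submodule_vimage_mult: "submodule M \<Longrightarrow> submodule {x. c * x \<in> M}"
  by (auto simp: submodule_def distrib_left mult.left_commute)

text \<open>Both inclusions follow from minimality, by the image and the preimage of a submodule
  under multiplication. So \<open>c = 0\<close> is no exception, and some \<open>q i\<close> may
  vanish at special parameters.\<close>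

lemma ideal_gen_image_mult: "ideal_gen R ((*) c ` A) = (*) c ` ideal_gen R A"
proof
  show "ideal_gen R ((*) c ` A) \<subseteq> (*) c ` ideal_gen R A"
    by (intro ideal_gen_least submodule_image_mult submodule_ideal_gen)
      (auto intro: ideal_gen_superset)
  have "ideal_gen R A \<subseteq> {x. c * x \<in> ideal_gen R ((*) c ` A)}"
    by (intro ideal_gen_least submodule_vimage_mult submodule_ideal_gen)
      (auto intro: ideal_gen_superset)
  then show "(*) c ` ideal_gen R A \<subseteq> ideal_gen R ((*) c ` A)"
    by auto
qed

lemma ideal_mult_image_mult:
  "ideal_mult R ((*) c ` I) ((*) d ` J) = (*) (c * d) ` ideal_mult R I J"
proof -
  have "{a * b | a b. a \<in> (*) c ` I \<and> b \<in> (*) d ` J} = (*) (c * d) ` {a * b | a b. a \<in> I \<and> b \<in> J}"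
    by (auto simp: image_iff) (metis mult.assoc mult.left_commute)+
  then show ?thesis
    by (simp add: ideal_mult_def ideal_gen_image_mult)
qed

lemma ideal_gen_unit_multiples:
  assumes "is_unit_in R u" "is_unit_in R w"
  shows "ideal_gen R {u * a, w * b} = ideal_gen R {a, b}"
proof
  show "ideal_gen R {u * a, w * b} \<subseteq> ideal_gen R {a, b}"
    using assms by (intro ideal_gen_subsetI) (simp add: is_unit_in_def ideal_gen_multiple)
  have "inverse u * (u * a) \<in> ideal_gen R {u * a, w * b}" "inverse w * (w * b) \<in> ideal_gen R {u * a, w * b}"
    by (intro ideal_gen_multiple; use assms in \<open>simp add: is_unit_in_def\<close>)+
  then have "a \<in> ideal_gen R {u * a, w * b}" "b \<in> ideal_gen R {u * a, w * b}"
    using assms by (simp_all add: is_unit_in_def flip: mult.assoc)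
  then show "ideal_gen R {a, b} \<subseteq> ideal_gen R {u * a, w * b}"
    by (intro ideal_gen_subsetI) auto
qed

lemma image_unit_mult:
  assumes "is_unit_in R u" and M: "submodule M"
  shows "(*) (u * c) ` M = (*) c ` M"
proof -
  have "u * c * x \<in> (*) c ` M" if "x \<in> M" for x
    using submodule_scale[OF M _ that, of u] assms(1)
    by (auto simp: is_unit_in_def image_iff intro!: bexI[of _ "u * x"])
  moreover have "c * x \<in> (*) (u * c) ` M" if "x \<in> M" for x
    using submodule_scale[OF M _ that, of "inverse u"] assms(1)
    by (auto simp: is_unit_in_def image_iff intro!: bexI[of _ "inverse u * x"])
  ultimately show ?thesis
    by auto
qed

text \<open>The point to prove is \<open>(x, y, z) = J\<^sup>2\<close>. The ideal \<open>M\<close>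
  of all values contains every product of neighbours \<open>q (prev j) * q j\<close>. Both
  neighbours of \<open>q j\<close> generate \<open>J\<close>, hence \<open>q j * J\<close> lies in
  \<open>M\<close>; and since \<open>J\<close> is generated by \<open>q (prev i)\<close> and
  \<open>q (next' i)\<close>, so does \<open>J * J\<close>.\<close>

lemma cyclic_ideal_equation:
  fixes q \<epsilon> G :: "nat \<Rightarrow> 'a" and n :: nat
  defines "prev \<equiv> \<lambda>i. (i + n - 1) mod n" and "next' \<equiv> \<lambda>i. (i + 1) mod n"
  assumes unit: "\<And>i. i < n \<Longrightarrow> is_unit_in R (\<epsilon> i)"
    and G: "\<And>i. i < n \<Longrightarrow> G i = \<epsilon> i * (q (prev i) * q i)"
    and J: "\<And>i. i < n \<Longrightarrow> ideal_gen R {q (prev i), q (next' i)} = J"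
    and X: "ideal_gen R X = ideal_gen R (G ` {..<n})"
    and i: "i < n"
  shows "(*) (G i) ` ideal_gen R X =
    ideal_mult R (ideal_gen R {G (prev i), G i}) (ideal_gen R {G i, G (next' i)})"
proof -
  have prev: "prev j = (if j = 0 then n - 1 else j - 1)" if "j < n" for j
  proof (cases j)
    case (Suc k)
    then show ?thesis
      using that by (simp add: prev_def)
  qed (use that in \<open>simp add: prev_def\<close>)
  have next': "next' j = (if j + 1 = n then 0 else j + 1)" if "j < n" for j
    using that by (auto simp: next'_def)
  have cyc: "prev j < n" "next' j < n" "next' (prev j) = j" "prev (next' j) = j" if "j < n" for j
    using that by (auto simp: prev next')
  note subm = submodule_ideal_gen
  have mem_J: "q j \<in> J" "q (prev j) \<in> J" if "j < n" for j
    using J[OF cyc(1)[OF that]] J[OF that] cyc(3)[OF that]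
      ideal_gen_superset[of _ "{q (prev (prev j)), q j}"] ideal_gen_superset[of _ "{q (prev j), q (next' j)}"]
    by auto
  have "ideal_gen R (G ` {..<n}) = ideal_mult R J J"
  proof
    have "G j \<in> ideal_mult R J J" if "j < n" for j
      unfolding G[OF that] ideal_mult_def
      using unit[OF that] mem_J[OF that]
      by (intro ideal_gen_multiple) (auto simp: is_unit_in_def)
    then show "ideal_gen R (G ` {..<n}) \<subseteq> ideal_mult R J J"
      unfolding ideal_mult_def by (intro ideal_gen_subsetI) auto
  next
    define M where "M = ideal_gen R (G ` {..<n})"
    have M: "submodule M"
      by (simp add: M_def subm)
    have prod: "q (prev j) * q j \<in> M" if "j < n" for j
    proof -
      have "inverse (\<epsilon> j) * G j \<in> M"
        using unit[OF that] that by (simp add: M_def is_unit_in_def ideal_gen_multiple)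
      then show ?thesis
        using unit[OF that] by (simp add: G[OF that] is_unit_in_def flip: mult.assoc)
    qed
    have qJ: "J \<subseteq> {t. q j * t \<in> M}" if "j < n" for j
      unfolding J[OF that, symmetric]
      using prod[OF that] prod[OF cyc(2)[OF that]] cyc(4)[OF that]
      by (intro ideal_gen_least submodule_vimage_mult M) (auto simp: mult.commute)
    have "J \<subseteq> {s. t * s \<in> M}" if "t \<in> J" for t
      unfolding J[OF i, symmetric]
      using qJ[OF cyc(1)[OF i]] qJ[OF cyc(2)[OF i]] that
      by (intro ideal_gen_least submodule_vimage_mult M) (auto simp: mult.commute)
    then show "ideal_mult R J J \<subseteq> ideal_gen R (G ` {..<n})"
      unfolding ideal_mult_def M_def[symmetric] by (intro ideal_gen_least M) auto
  qed
  moreover have "ideal_gen R {G (prev i), G i} = (*) (q (prev i)) ` J"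
  proof -
    let ?p = "prev i"
    have "{G ?p, G i} = (*) (q ?p) ` {\<epsilon> ?p * q (prev ?p), \<epsilon> i * q i}"
      by (simp add: G[OF i] G[OF cyc(1)[OF i]] mult_ac)
    then show ?thesis
      using J[OF cyc(1)[OF i]] cyc(3)[OF i] unit[OF i] unit[OF cyc(1)[OF i]]
      by (simp only: ideal_gen_image_mult ideal_gen_unit_multiples)
  qed
  moreover have "ideal_gen R {G i, G (next' i)} = (*) (q i) ` J"
  proof -
    let ?s = "next' i"
    have "{G i, G ?s} = (*) (q i) ` {\<epsilon> i * q (prev i), \<epsilon> ?s * q ?s}"
      by (simp add: G[OF i] G[OF cyc(2)[OF i]] cyc(4)[OF i] mult_ac)
    then show ?thesis
      using J[OF i] unit[OF i] unit[OF cyc(2)[OF i]]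
      by (simp only: ideal_gen_image_mult ideal_gen_unit_multiples)
  qed
  moreover have "(*) (G i) ` ideal_mult R J J = (*) (q (prev i) * q i) ` ideal_mult R J J"
    unfolding G[OF i] by (rule image_unit_mult[OF unit[OF i]]) (simp add: ideal_mult_def subm)
  ultimately show ?thesis
    by (simp only: X ideal_mult_image_mult)
qed

end

section \<open>Zariski density\<close>

definition polynomial_fun :: "('a::comm_ring_1 ^ 3 \<Rightarrow> 'a) \<Rightarrow> bool" where
  "polynomial_fun f \<longleftrightarrow> (\<exists>p. f = eval3 p)"

lemma polynomial_fun_const: "polynomial_fun (\<lambda>_. c)"
  unfolding polynomial_fun_def by (intro exI[of _ "[:[:[:c:]:]:]"]) (simp add: eval3_def fun_eq_iff)

lemma polynomial_fun_coord: "polynomial_fun (\<lambda>v. v $ i)"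
proof -
  have "(\<lambda>v::'a^3. v $ 1) = eval3 [:[:[:0, 1:]:]:]" "(\<lambda>v::'a^3. v $ 2) = eval3 [:[:0, 1:]:]"
    "(\<lambda>v::'a^3. v $ 3) = eval3 [:0, 1:]"
    by (simp_all add: eval3_def fun_eq_iff)
  then show ?thesis
    using exhaust_3[of i] unfolding polynomial_fun_def by metis
qed

lemma polynomial_fun_add: "polynomial_fun f \<Longrightarrow> polynomial_fun g \<Longrightarrow> polynomial_fun (\<lambda>v. f v + g v)"
  and polynomial_fun_mult: "polynomial_fun f \<Longrightarrow> polynomial_fun g \<Longrightarrow> polynomial_fun (\<lambda>v. f v * g v)"
proof -
  assume "polynomial_fun f" "polynomial_fun g"
  then obtain p q where "f = eval3 p" "g = eval3 q"
    by (auto simp: polynomial_fun_def)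
  then have "(\<lambda>v. f v + g v) = eval3 (p + q)" "(\<lambda>v. f v * g v) = eval3 (p * q)"
    by (simp_all add: eval3_def fun_eq_iff)
  then show "polynomial_fun (\<lambda>v. f v + g v)" "polynomial_fun (\<lambda>v. f v * g v)"
    by (auto simp: polynomial_fun_def)
qed

lemma polynomial_fun_minus:
  assumes "polynomial_fun f"
  shows "polynomial_fun (\<lambda>v. - f v)"
  using polynomial_fun_mult[OF polynomial_fun_const[of "- 1"] assms] by simp

lemma polynomial_fun_diff:
  assumes "polynomial_fun f" "polynomial_fun g"
  shows "polynomial_fun (\<lambda>v. f v - g v)"
  using polynomial_fun_add[OF assms(1) polynomial_fun_minus[OF assms(2)]] by simp

lemmas polynomial_fun_intros =
  polynomial_fun_const polynomial_fun_coord polynomial_fun_add polynomial_fun_mult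
  polynomial_fun_minus polynomial_fun_diff

text \<open>Horner's scheme, applied to one variable at a time from the innermost coefficients
  outwards.\<close>

lemma polynomial_fun_eval3_compose:
  assumes \<Phi>: "\<And>i. polynomial_fun (\<lambda>t. \<Phi> t $ i)"
  shows "polynomial_fun (\<lambda>t. eval3 p (\<Phi> t))"
proof -
  have 1: "polynomial_fun (\<lambda>t. poly r (\<Phi> t $ 1))" for r :: "'a poly"
    by (induction r) (simp_all add: polynomial_fun_intros \<Phi>)
  have 2: "polynomial_fun (\<lambda>t. poly (poly r [:\<Phi> t $ 2:]) (\<Phi> t $ 1))" for r :: "'a poly poly"
    by (induction r) (simp_all add: polynomial_fun_intros \<Phi> 1)
  have "polynomial_fun (\<lambda>t. poly (poly (poly p [:[:\<Phi> t $ 3:]:]) [:\<Phi> t $ 2:]) (\<Phi> t $ 1))"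
    by (induction p) (simp_all add: polynomial_fun_intros \<Phi> 2)
  then show ?thesis
    by (simp add: eval3_def)
qed

lemma poly_eq_0_if_infinite_zeros:
  fixes p :: "'a::idom poly"
  assumes "infinite A" and "\<And>x. x \<in> A \<Longrightarrow> poly p x = 0"
  shows "p = 0"
  using assms poly_roots_finite[of p] finite_subset[of A "{x. poly p x = 0}"] by blast

text \<open>A nonzero polynomial over a domain has finitely many roots. This is used over
  \<open>k[x][y]\<close>, \<open>k[x]\<close> and \<open>k\<close> in turn, with the elements of
  \<open>U\<close> embedded as constants.\<close>

lemma eval3_eq_0_on_grid:
  fixes p :: "'a::field poly poly poly"
  assumes U: "infinite U" and zero: "\<And>v. (\<And>i. v $ i \<in> U) \<Longrightarrow> eval3 p v = 0"
  shows "p = 0"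
proof (rule poly_eq_0_if_infinite_zeros)
  show "infinite ((\<lambda>z. [:[:z:]:]) ` U)"
    using U by (auto dest!: finite_imageD simp: inj_on_def)
  fix c assume "c \<in> (\<lambda>z. [:[:z:]:]) ` U"
  then obtain z where z: "z \<in> U" "c = [:[:z:]:]"
    by blast
  show "poly p c = 0"
  proof (rule poly_eq_0_if_infinite_zeros)
    show "infinite ((\<lambda>y. [:y:]) ` U)"
      using U by (auto dest!: finite_imageD simp: inj_on_def)
    fix b assume "b \<in> (\<lambda>y. [:y:]) ` U"
    then obtain y where y: "y \<in> U" "b = [:y:]"
      by blast
    show "poly (poly p c) b = 0"
    proof (rule poly_eq_0_if_infinite_zeros[OF U])
      fix x assume "x \<in> U"
      have "vector [x, y, z] $ i \<in> U" for i :: 3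
        using exhaust_3[of i] y z \<open>x \<in> U\<close> by (auto simp: vector_3)
      then show "poly (poly (poly p c) b) x = 0"
        using zero[of "vector [x, y, z]"] y z by (simp add: eval3_def vector_3)
    qed
  qed
qed

text \<open>
  A polynomial vanishing on \<open>X\<close> pulls back to one that vanishes on \<open>U \<times> U \<times> U\<close>, hence identically.
  So it vanishes on the image of \<open>\<Phi>\<close>, which contains the nonempty open set \<open>h \<noteq> 0\<close>.
\<close>

lemma zariski_dense_if_parametrized:
  fixes \<Phi> :: "'a::field ^ 3 \<Rightarrow> 'a ^ 3"
  assumes U: "infinite U" and \<Phi>: "\<And>i. polynomial_fun (\<lambda>t. \<Phi> t $ i)"
    and h: "polynomial_fun h" "h w \<noteq> 0" and surj: "\<And>v. h v \<noteq> 0 \<Longrightarrow> \<exists>t. \<Phi> t = v"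
    and X: "\<And>t. (\<And>i. t $ i \<in> U) \<Longrightarrow> \<Phi> t \<in> X"
  shows "zariski_dense X"
  unfolding zariski_dense_def
proof (intro allI impI)
  fix Z assume "zariski_closed Z \<and> X \<subseteq> Z"
  then obtain P where P: "Z = {v. \<forall>p\<in>P. eval3 p v = 0}" and "X \<subseteq> Z"
    by (auto simp: zariski_closed_def)
  have zero: "p = 0" if "p \<in> P" for p
  proof -
    obtain q where q: "(\<lambda>t. eval3 p (\<Phi> t)) = eval3 q"
      using polynomial_fun_eval3_compose[OF \<Phi>] by (auto simp: polynomial_fun_def)
    have "q = 0"
    proof (rule eval3_eq_0_on_grid[OF U])
      fix t :: "'a ^ 3" assume "\<And>i. t $ i \<in> U"
      then have "eval3 p (\<Phi> t) = 0"
        using X \<open>X \<subseteq> Z\<close> P that by blast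
      then show "eval3 q t = 0"
        using q by metis
    qed
    then have image: "eval3 p (\<Phi> t) = 0" for t
      using fun_cong[OF q, of t] by (simp add: eval3_def)
    obtain r where r: "h = eval3 r"
      using h(1) by (auto simp: polynomial_fun_def)
    have "r \<noteq> 0"
      using h(2) r by (auto simp: eval3_def)
    \<comment> \<open>Zeros of \<open>h\<close> may lie outside the image of \<open>\<Phi>\<close>;
      multiplying by \<open>r\<close> takes care of them, and the polynomial ring has no zero
      divisors.\<close>
    moreover have "p * r = 0"
    proof (rule eval3_eq_0_on_grid[OF U])
      fix v :: "'a ^ 3"
      have "eval3 p v = 0 \<or> eval3 r v = 0"
        using surj[of v] image r by auto
      then show "eval3 (p * r) v = 0"
        by (auto simp: eval3_def)
    qed
    ultimately show ?thesis
      by simp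
  qed
  have "eval3 p v = 0" if "p \<in> P" for p v
    using zero[OF that] by (simp add: eval3_def)
  then show "Z = UNIV"
    unfolding P by blast
qed

lemma infinite_powers_of_two: "infinite (range (\<lambda>k. (2::'a::field_char_0) ^ k))"
proof
  assume "finite (range (\<lambda>k. (2::'a) ^ k))"
  moreover have "inj (\<lambda>k. (2::'a) ^ k)"
  proof (rule injI)
    fix i j assume "(2::'a) ^ i = 2 ^ j"
    then have "(of_nat (2 ^ i) :: 'a) = of_nat (2 ^ j)"
      by simp
    then show "i = j"
      unfolding of_nat_eq_iff by simp
  qed
  ultimately show False
    using finite_imageD by blast
qed

section \<open>Dual bases of linear forms\<close>

text \<open>Affine space is irreducible, so the factors of \<open>h\<close> can be tested at
  different points.\<close>

lemma polynomial_fun_mult_nonzero: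
  fixes f g :: "'a::field_char_0 ^ 3 \<Rightarrow> 'a"
  assumes f: "polynomial_fun f" "\<exists>v. f v \<noteq> 0" and g: "polynomial_fun g" "\<exists>v. g v \<noteq> 0"
  shows "\<exists>v. f v * g v \<noteq> 0"
proof (rule ccontr)
  assume *: "\<nexists>v. f v * g v \<noteq> 0"
  obtain p q where pq: "f = eval3 p" "g = eval3 q"
    using f g by (auto simp: polynomial_fun_def)
  have "p * q = 0"
    by (rule eval3_eq_0_on_grid[OF infinite_powers_of_two]) (use * pq in \<open>auto simp: eval3_def\<close>)
  then show False
    using f(2) g(2) pq by (auto simp: eval3_def)
qed

lemma scalar_product_3: "scalar_product a (v :: 'a::field ^ 3) = a $ 1 * v $ 1 + a $ 2 * v $ 2 + a $ 3 * v $ 3"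
  by (simp add: scalar_product_def sum_3)

lemma matrix_vector_mult_3: "(E *v (w :: 'a::field ^ 3)) $ i = E $ i $ 1 * w $ 1 + E $ i $ 2 * w $ 2 + E $ i $ 3 * w $ 3"
  by (simp add: matrix_vector_mult_def sum_3)

text \<open>\<open>E\<close> is the inverse of the matrix with rows \<open>G1\<close>,
  \<open>G2\<close>, \<open>G3\<close>. It allows a point to be prescribed by the values of three
  forms.\<close>

definition dual_to :: "'a::field ^ 3 \<Rightarrow> 'a ^ 3 \<Rightarrow> 'a ^ 3 \<Rightarrow> 'a ^ 3 ^ 3 \<Rightarrow> bool" where
  "dual_to G1 G2 G3 E \<longleftrightarrow>
     (\<forall>w. scalar_product G1 (E *v w) = w $ 1 \<and> scalar_product G2 (E *v w) = w $ 2 \<and>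
          scalar_product G3 (E *v w) = w $ 3) \<and>
     (\<forall>v. E *v vector [scalar_product G1 v, scalar_product G2 v, scalar_product G3 v] = v)"

lemma dual_basis_exists:
  fixes G1 G2 G3 :: "'a::field ^ 3"
  assumes ind: "vec.independent {G1, G2, G3}" and distinct: "G1 \<noteq> G2" "G1 \<noteq> G3" "G2 \<noteq> G3"
  shows "\<exists>E. dual_to G1 G2 G3 E"
proof -
  define A :: "'a ^ 3 ^ 3" where "A = vector [G1, G2, G3]"
  have A: "A $ 1 = G1" "A $ 2 = G2" "A $ 3 = G3"
    by (simp_all add: A_def vector_3)
  have "(\<Sum>i\<in>UNIV. c i *s row i A) = 0 \<longrightarrow> (\<forall>i. c i = 0)" for c :: "3 \<Rightarrow> 'a"
  proof
    assume sum: "(\<Sum>i\<in>UNIV. c i *s row i A) = 0"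
    define u where "u x = (if x = G1 then c 1 else if x = G2 then c 2 else c 3)" for x
    have "row i A = A $ i" for i
      by (simp add: row_def vec_eq_iff)
    then have "(\<Sum>x\<in>{G1, G2, G3}. u x *s x) = 0"
      using sum distinct by (simp add: sum_3 A u_def add.assoc)
    then have "u x = 0" if "x \<in> {G1, G2, G3}" for x
      using vec.independentD[OF ind _ subset_refl _ that] by simp
    from this[of G1] this[of G2] this[of G3] show "\<forall>i. c i = 0"
      using distinct by (simp add: u_def forall_3)
  qed
  then have "\<exists>E::'a ^ 3 ^ 3. A ** E = mat 1"
    unfolding matrix_right_invertible_independent_rows by (rule allI)
  then obtain E :: "'a ^ 3 ^ 3" where E: "A ** E = mat 1" ..
  have A_v: "(A *v v) $ i = scalar_product (A $ i) v" for v i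
    by (simp add: matrix_vector_mult_def scalar_product_def)
  have "A *v (E *v w) = w" for w
    by (simp add: matrix_vector_mul_assoc E)
  then have "scalar_product (A $ i) (E *v w) = w $ i" for w i
    using A_v[of "E *v w" i] by simp
  moreover have "E *v (A *v v) = v" for v
    using E by (simp add: matrix_vector_mul_assoc matrix_left_right_inverse1)
  moreover have "A *v v = vector [scalar_product G1 v, scalar_product G2 v, scalar_product G3 v]" for v
    by (simp add: vec_eq_iff forall_3 A_v A vector_3)
  ultimately have "dual_to G1 G2 G3 E"
    unfolding dual_to_def by (simp flip: A)
  then show ?thesis
    by blast
qed

lemma scalar_product_dual_to:
  assumes "dual_to G1 G2 G3 E"
  shows "scalar_product H v = scalar_product H (column 1 E) * scalar_product G1 v +
    scalar_product H (column 2 E) * scalar_product G2 v + scalar_product H (column 3 E) * scalar_product G3 v"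
proof -
  have "scalar_product H (E *v w) = scalar_product H (column 1 E) * w $ 1 +
      scalar_product H (column 2 E) * w $ 2 + scalar_product H (column 3 E) * w $ 3" for w
    by (simp add: scalar_product_3 matrix_vector_mult_3 column_def algebra_simps)
  from this[of "vector [scalar_product G1 v, scalar_product G2 v, scalar_product G3 v]"] show ?thesis
    using assms by (simp add: dual_to_def vector_3)
qed

lemma general_position_dual:
  assumes "general_position n F" and "i < n" "j < n" "k < n" and "i \<noteq> j" "i \<noteq> k" "j \<noteq> k"
  shows "\<exists>E. dual_to (F i) (F j) (F k) E"
proof -
  have "3 \<le> n"
    using assms(2-) by linarith
  then have "{i, j, k} \<subseteq> {..<n}" "card {i, j, k} = min 3 n"
    using assms(2-) by simp_all
  then have "inj_on F {i, j, k}" "vec.independent (F ` {i, j, k})"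
    using assms(1) unfolding general_position_def by blast+
  then show ?thesis
    using assms(5-) by (intro dual_basis_exists) (simp_all add: inj_on_eq_iff[of F])
qed

text \<open>If, say, \<open>a\<close> were zero, then \<open>F l\<close> would vanish wherever
  \<open>F j\<close> and \<open>F k\<close> do, although a basis dual to these three forms has a
  vector on which \<open>F l\<close> is 1 and the other two are 0.\<close>

lemma general_position_coefficients:
  assumes gp: "general_position n F" and "i < n" "j < n" "k < n" "l < n"
    and "i \<noteq> j" "i \<noteq> k" "j \<noteq> k" "l \<notin> {i, j, k}"
  obtains a b c where "a \<noteq> 0" "b \<noteq> 0" "c \<noteq> 0"
    and "\<And>v. scalar_product (F l) v =
      a * scalar_product (F i) v + b * scalar_product (F j) v + c * scalar_product (F k) v"
proof -
  obtain E where E: "dual_to (F i) (F j) (F k) E"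
    using general_position_dual assms by metis
  define a b c where "a = scalar_product (F l) (column 1 E)" and "b = scalar_product (F l) (column 2 E)"
    and "c = scalar_product (F l) (column 3 E)"
  have sum: "scalar_product (F l) v =
      a * scalar_product (F i) v + b * scalar_product (F j) v + c * scalar_product (F k) v" for v
    unfolding a_def b_def c_def by (rule scalar_product_dual_to[OF E])
  have separate: "\<exists>v. scalar_product (F l) v = 1 \<and> scalar_product (F x) v = 0 \<and> scalar_product (F y) v = 0"
    if xy: "x < n" "y < n" "x \<noteq> y" "l \<noteq> x" "l \<noteq> y" for x y
  proof -
    obtain E' where "dual_to (F l) (F x) (F y) E'"
      using general_position_dual[OF gp \<open>l < n\<close> xy(1,2,4,5,3)] by blast
    then show ?thesis
      by (intro exI[of _ "E' *v vector [1, 0, 0]"]) (simp add: dual_to_def vector_3)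
  qed
  have "a \<noteq> 0"
    using separate[of j k] sum assms by force
  moreover have "b \<noteq> 0"
    using separate[of i k] sum assms by force
  moreover have "c \<noteq> 0"
    using separate[of i j] sum assms by force
  ultimately show thesis
    using that sum by blast
qed

text \<open>Fewer than three values do not determine a point, so auxiliary forms complete the given
  ones to a basis.\<close>

lemma extend_to_three_independent:
  assumes "general_position n F" and "n \<le> 3"
  obtains F' :: "nat \<Rightarrow> 'a::field ^ 3" where "\<And>i. i < n \<Longrightarrow> F' i = F i"
    and "\<exists>E. dual_to (F' 0) (F' 1) (F' 2) E"
proof -
  have F: "inj_on F {..<n}" "vec.independent (F ` {..<n})"
    using assms by (auto simp: general_position_def)
  define B where "B = vec.extend_basis (F ` {..<n})"
  have B: "F ` {..<n} \<subseteq> B" "vec.independent B" "vec.span B = UNIV"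
    unfolding B_def using F(2) vec.extend_basis_superset vec.independent_extend_basis by auto
  have "card B = 3"
    using vec.dim_eq_card[of B UNIV] B by (simp add: card_cart_basis)
  then have "finite B"
    by (metis card.infinite zero_neq_numeral)
  have "card (B - F ` {..<n}) = 3 - n"
    using B(1) F(1) \<open>card B = 3\<close> by (simp add: card_Diff_subset card_image)
  then obtain g where g: "bij_betw g {n..<3} (B - F ` {..<n})"
    using \<open>finite B\<close> by (metis card_atLeastLessThan finite_Diff finite_atLeastLessThan finite_same_card_bij)
  define F' where "F' i = (if i < n then F i else g i)" for i
  have "F' ` {..<n} = F ` {..<n}" "F' ` {n..<3} = g ` {n..<3}"
    by (auto simp: F'_def)
  moreover have inj: "inj_on F' {..<3}"
  proof -
    have "{..<3} = {..<n} \<union> {n..<3}"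
      using \<open>n \<le> 3\<close> by auto
    moreover have "inj_on F' {..<n}" "inj_on F' {n..<3}"
      using F(1) g by (auto simp: F'_def inj_on_def bij_betw_def)
    moreover have "F' ` {..<n} \<inter> F' ` {n..<3} = {}"
      using g by (auto simp: F'_def bij_betw_def)
    ultimately show ?thesis
      by (simp add: inj_on_Un) blast
  qed
  ultimately have "F' ` {..<3} = B"
  proof -
    have "F' ` {..<3} \<subseteq> B"
      using B(1) bij_betwE[OF g] by (auto simp: F'_def)
    moreover have "card (F' ` {..<3}) = card B"
      using inj \<open>card B = 3\<close> by (simp add: card_image)
    ultimately show ?thesis
      using \<open>finite B\<close> by (simp add: card_subset_eq)
  qed
  moreover have "F' ` {..<3} = {F' 0, F' 1, F' 2}"
    by (auto simp: numeral_eq_Suc lessThan_Suc)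
  ultimately have "\<exists>E. dual_to (F' 0) (F' 1) (F' 2) E"
    using B(2) inj by (intro dual_basis_exists) (auto simp: inj_on_eq_iff)
  then show thesis
    using that[of F'] by (simp add: F'_def)
qed

section \<open>Parametrized solutions\<close>

definition solutions :: "nat \<Rightarrow> (nat \<Rightarrow> 'a::field ^ 3) \<Rightarrow> 'a set \<Rightarrow> ('a ^ 3) set" where
  "solutions n F R = {v. (\<forall>j. v $ j \<in> R) \<and>
      (\<forall>i<n.
        let F_prev = scalar_product (F ((i + n - 1) mod n)) v;
            F_this = scalar_product (F i) v;
            F_next = scalar_product (F ((i + 1) mod n)) v
        in (\<lambda>a. F_this * a) ` ideal_gen R {v $ 1, v $ 2, v $ 3} =
           ideal_mult R (ideal_gen R {F_prev, F_this}) (ideal_gen R {F_this, F_next}))}"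

definition cyclic_factorization :: "nat \<Rightarrow> 'a::field set \<Rightarrow> (nat \<Rightarrow> 'a) \<Rightarrow> bool" where
  "cyclic_factorization n R G \<longleftrightarrow> (\<exists>q \<epsilon> J. \<forall>i<n. is_unit_in R (\<epsilon> i) \<and>
      G i = \<epsilon> i * (q ((i + n - 1) mod n) * q i) \<and>
      ideal_gen R {q ((i + n - 1) mod n), q ((i + 1) mod n)} = J)"

context field_subring
begin

lemma diff_mem: "x \<in> R \<Longrightarrow> y \<in> R \<Longrightarrow> x - y \<in> R"
  using add_mem[of x "- y"] minus_mem[of y] by simp

lemma is_unit_in_mult: "is_unit_in R x \<Longrightarrow> is_unit_in R y \<Longrightarrow> is_unit_in R (x * y)"
  by (simp add: is_unit_in_def mult_mem)

lemma is_unit_in_one: "is_unit_in R 1"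
  by (simp add: is_unit_in_def)

lemma is_unit_in_power: "is_unit_in R x \<Longrightarrow> is_unit_in R (x ^ k)"
  by (induction k) (simp_all add: is_unit_in_one is_unit_in_mult)

lemma ideal_gen_eq_ring:
  assumes "1 \<in> ideal_gen R A" and "A \<subseteq> R"
  shows "ideal_gen R A = R"
proof
  show "ideal_gen R A \<subseteq> R"
    using assms(2) by (intro ideal_gen_least) (auto simp: submodule_def add_mem mult_mem)
  show "R \<subseteq> ideal_gen R A"
    using submodule_scale[OF submodule_ideal_gen _ assms(1)] by auto
qed

lemma ideal_gen_pairI: "r \<in> R \<Longrightarrow> s \<in> R \<Longrightarrow> x = r * a + s * b \<Longrightarrow> x \<in> ideal_gen R {a, b}"
  by (auto intro!: submodule_add[OF submodule_ideal_gen] ideal_gen_multiple)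

lemma ideal_gen_pair_eqI:
  assumes "c \<in> ideal_gen R {a, b}" "d \<in> ideal_gen R {a, b}" "a \<in> ideal_gen R {c, d}" "b \<in> ideal_gen R {c, d}"
  shows "ideal_gen R {c, d} = ideal_gen R {a, b}"
  using assms by (intro equalityI ideal_gen_subsetI) auto

text \<open>The coefficients of the forms lie in \<open>R\<close>, so all values lie in
  \<open>(x, y, z)\<close>; \<open>gen\<close> is the opposite inclusion. Together they allow the
  values to replace the coordinates as generators.\<close>

lemma mem_solutions:
  fixes F :: "nat \<Rightarrow> 'a ^ 3"
  assumes F: "\<And>i j. i < n \<Longrightarrow> F i $ j \<in> R" and v: "\<And>j. v $ j \<in> R"
    and gen: "\<And>j. v $ j \<in> ideal_gen R ((\<lambda>i. scalar_product (F i) v) ` {..<n})"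
    and fact: "cyclic_factorization n R (\<lambda>i. scalar_product (F i) v)"
  shows "v \<in> solutions n F R"
proof -
  let ?X = "{v $ 1, v $ 2, v $ 3}"
  let ?G = "\<lambda>i. scalar_product (F i) v"
  obtain q \<epsilon> J where q: "\<And>i. i < n \<Longrightarrow> is_unit_in R (\<epsilon> i)"
      "\<And>i. i < n \<Longrightarrow> ?G i = \<epsilon> i * (q ((i + n - 1) mod n) * q i)"
      "\<And>i. i < n \<Longrightarrow> ideal_gen R {q ((i + n - 1) mod n), q ((i + 1) mod n)} = J"
    using fact unfolding cyclic_factorization_def by blast
  have X: "ideal_gen R ?X = ideal_gen R (?G ` {..<n})"
  proof (intro equalityI ideal_gen_subsetI)
    show "?G ` {..<n} \<subseteq> ideal_gen R ?X"
      using F by (auto simp: scalar_product_3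
          intro!: submodule_add[OF submodule_ideal_gen] ideal_gen_multiple)
  qed (use gen in auto)
  have "(*) (?G i) ` ideal_gen R ?X =
      ideal_mult R (ideal_gen R {?G ((i + n - 1) mod n), ?G i}) (ideal_gen R {?G i, ?G ((i + 1) mod n)})"
    if "i < n" for i
    using cyclic_ideal_equation[where G = ?G and X = ?X, OF q X that] by simp
  then show ?thesis
    using v unfolding solutions_def Let_def by blast
qed

end

text \<open>Common frame of the three cases: \<open>\<Psi> t\<close> lists the values of
  \<open>G1\<close>, \<open>G2\<close>, \<open>G3\<close>, and \<open>E\<close> turns them into a
  point. As \<open>S\<close> is constructed only inside, \<open>factorization\<close> has to hold
  over every subring in which the nonzero elements of \<open>C\<close> and the parameters are
  units.\<close>

lemma zariski_dense_solutions:
  fixes F :: "nat \<Rightarrow> 'a::field_char_0 ^ 3" and \<Psi> :: "'a ^ 3 \<Rightarrow> 'a ^ 3"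
  assumes nf: "number_field TYPE('a)" and E: "dual_to G1 G2 G3 E" and "finite C"
    and \<Psi>: "\<And>i. polynomial_fun (\<lambda>t. \<Psi> t $ i)"
    and h: "polynomial_fun h" "\<exists>w. h w \<noteq> 0" and surj: "\<And>w. h w \<noteq> 0 \<Longrightarrow> \<exists>t. \<Psi> t = w"
    and factorization: "\<And>R t. field_subring R \<Longrightarrow> C \<subseteq> R \<Longrightarrow> (\<And>c. c \<in> C \<Longrightarrow> c \<noteq> 0 \<Longrightarrow> is_unit_in R c) \<Longrightarrow>
      (\<And>i. is_unit_in R (t $ i)) \<Longrightarrow>
      (\<forall>i. \<Psi> t $ i \<in> R \<and> \<Psi> t $ i \<in> ideal_gen R ((\<lambda>i. scalar_product (F i) (E *v \<Psi> t)) ` {..<n})) \<and>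
      cyclic_factorization n R (\<lambda>i. scalar_product (F i) (E *v \<Psi> t))"
  shows "\<exists>S. finite S \<and> archimedean_places \<subseteq> S \<and> S \<subseteq> places \<and> zariski_dense (solutions n F (S_integers S))"
proof -
  \<comment> \<open>The entries of \<open>E\<close> belong here because they must lie in the ring
    for the point to be integral and its coordinates to lie in the ideal of the values. Coefficients
    may be zero, hence the later restriction to \<open>D - {0}\<close>.\<close>
  define D where "D = insert 2 (C \<union> (\<Union>i<n. range (($) (F i))) \<union> (\<Union>i. range (($) (E $ i))))"
  have "finite D"
    using \<open>finite C\<close> by (simp add: D_def)
  then obtain S :: "('a \<Rightarrow> real) set set" where S: "finite S" "archimedean_places \<subseteq> S" "S \<subseteq> places"
    and "field_subring (S_integers S)" and "\<And>d. d \<in> D - {0} \<Longrightarrow> is_unit_in (S_integers S) d"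
    using S_integers_with_units[OF nf, of "D - {0}"] by blast
  define R where "R = S_integers S"
  interpret field_subring R
    unfolding R_def by fact
  have unit_D: "is_unit_in R d" if "d \<in> D" "d \<noteq> 0" for d
    using \<open>\<And>d. d \<in> D - {0} \<Longrightarrow> _\<close> that by (simp add: R_def)
  then have D: "d \<in> R" if "d \<in> D" for d
    using that by (cases "d = 0") (auto simp: is_unit_in_def)
  have "C \<subseteq> D"
    by (auto simp: D_def)
  have F_mem: "F i $ j \<in> R" if "i < n" for i j
    by (rule D) (use that in \<open>auto simp: D_def\<close>)
  have E_mem: "E $ i $ j \<in> R" for i j
    by (rule D) (unfold D_def, blast)
  have two: "is_unit_in R 2"
    by (rule unit_D) (simp_all add: D_def)
  define g :: "'a ^ 3 \<Rightarrow> 'a ^ 3" where "g v = vector [scalar_product G1 v, scalar_product G2 v, scalar_product G3 v]" for v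
  have E_g: "E *v g v = v" and g_E: "g (E *v w) = w" for v w
    using E by (simp_all add: g_def dual_to_def vec_eq_iff forall_3 vector_3)
  obtain r where r: "h = eval3 r"
    using h(1) by (auto simp: polynomial_fun_def)
  obtain w where w: "h w \<noteq> 0"
    using h(2) by blast
  have "zariski_dense (solutions n F R)"
  proof (rule zariski_dense_if_parametrized[OF infinite_powers_of_two])
    show "polynomial_fun (\<lambda>t. (E *v \<Psi> t) $ i)" for i
      unfolding matrix_vector_mult_3 by (intro polynomial_fun_intros \<Psi>)
    have "polynomial_fun (\<lambda>v. g v $ i)" for i
      using exhaust_3[of i] by (auto simp: g_def vector_3 scalar_product_3 intro!: polynomial_fun_intros)
    then show "polynomial_fun (\<lambda>v. h (g v))"
      unfolding r by (rule polynomial_fun_eval3_compose)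
    show "h (g (E *v w)) \<noteq> 0"
      by (simp add: g_E w)
    show "\<exists>t. E *v \<Psi> t = v" if "h (g v) \<noteq> 0" for v
      using surj[OF that] E_g by metis
  next
    fix t :: "'a ^ 3"
    assume "\<And>i. t $ i \<in> range (\<lambda>k. 2 ^ k)"
    then have unit_t: "is_unit_in R (t $ i)" for i
      using is_unit_in_power[OF two] by (metis imageE)
    have "C \<subseteq> R"
      using D \<open>C \<subseteq> D\<close> by blast
    have unit_C: "is_unit_in R c" if "c \<in> C" "c \<noteq> 0" for c
      using that \<open>C \<subseteq> D\<close> by (intro unit_D) auto
    note fact = factorization[OF field_subring_axioms \<open>C \<subseteq> R\<close> unit_C unit_t]
    have val: "\<Psi> t $ i \<in> R"
        "\<Psi> t $ i \<in> ideal_gen R ((\<lambda>i. scalar_product (F i) (E *v \<Psi> t)) ` {..<n})" for i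
      using fact by blast+
    show "E *v \<Psi> t \<in> solutions n F R"
    proof (rule mem_solutions[OF F_mem _ _ conjunct2[OF fact]])
      show "(E *v \<Psi> t) $ j \<in> R" for j
        unfolding matrix_vector_mult_3 by (intro add_mem mult_mem E_mem val)
      show "(E *v \<Psi> t) $ j \<in> ideal_gen R ((\<lambda>i. scalar_product (F i) (E *v \<Psi> t)) ` {..<n})" for j
        unfolding matrix_vector_mult_3[of E "\<Psi> t" j]
        by (intro submodule_add[OF submodule_ideal_gen] submodule_scale[OF submodule_ideal_gen] E_mem val)
    qed
  qed
  then show ?thesis
    using S unfolding R_def by blast
qed

section \<open>The families of solutions for each number of forms\<close>

lemma dense_solutions_le_3:
  fixes F :: "nat \<Rightarrow> 'a::field_char_0 ^ 3"
  assumes nf: "number_field TYPE('a)" and n: "1 \<le> n" "n \<le> 3" and gp: "general_position n F"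
  shows "\<exists>S. finite S \<and> archimedean_places \<subseteq> S \<and> S \<subseteq> places \<and> zariski_dense (solutions n F (S_integers S))"
proof -
  obtain F' E where F': "\<And>i. i < n \<Longrightarrow> F' i = F i" and E: "dual_to (F' 0) (F' 1) (F' 2) E"
    by (rule extend_to_three_independent[OF gp n(2)]) blast
  show ?thesis
  proof (rule zariski_dense_solutions[where C = "{}" and \<Psi> = "\<lambda>t. t" and h = "\<lambda>_. 1", OF nf E])
    fix R and t :: "'a ^ 3"
    assume R: "field_subring R" and t: "is_unit_in R (t $ i)" for i
    interpret field_subring R
      by fact
    let ?G = "\<lambda>i. scalar_product (F i) (E *v t)"
    have G: "is_unit_in R (?G i)" if "i < n" for i
    proof -
      have "i = 0 \<or> i = 1 \<or> i = 2"
        using that n by linarith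
      then show ?thesis
        using E t F'[OF that] by (auto simp: dual_to_def)
    qed
    have "inverse (?G 0) * ?G 0 \<in> ideal_gen R (?G ` {..<n})"
      using G[of 0] n by (intro ideal_gen_multiple) (auto simp: is_unit_in_def)
    then have one: "1 \<in> ideal_gen R (?G ` {..<n})"
      using G[of 0] n by (simp add: is_unit_in_def)
    have "t $ i \<in> ideal_gen R (?G ` {..<n})" for i
      using submodule_scale[OF submodule_ideal_gen _ one, of "t $ i"] t[of i] by (simp add: is_unit_in_def)
    moreover have "cyclic_factorization n R ?G"
      unfolding cyclic_factorization_def
      using G by (intro exI[of _ "\<lambda>_. 1"] exI[of _ ?G] exI[of _ "ideal_gen R {1, 1}"]) auto
    ultimately show "(\<forall>i. t $ i \<in> R \<and> t $ i \<in> ideal_gen R (?G ` {..<n})) \<and> cyclic_factorization n R ?G"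
      using t by (auto simp: is_unit_in_def)
  qed (auto intro: polynomial_fun_intros)
qed

text \<open>
  With \<open>q\<^sub>0 = 1\<close> and \<open>F 3 = a F 0 + b F 1 + c F 2\<close>, a suitable choice of the unit factors turns the
  condition on the \<open>q\<^sub>i\<close> into \<open>m q\<^sub>2 q\<^sub>3 = a c q\<^sub>3 + b q\<^sub>1 + q\<^sub>1 q\<^sub>2\<close> with a unit \<open>m\<close>. It is solved by
  \<open>q\<^sub>3 = s\<close>, \<open>q\<^sub>1 = m s - 1\<close>, \<open>q\<^sub>2 = a c s + b (m s - 1)\<close>, and \<open>(q\<^sub>1, q\<^sub>3) = (1)\<close>.
\<close>

lemma dense_solutions_4:
  fixes F :: "nat \<Rightarrow> 'a::field_char_0 ^ 3"
  assumes nf: "number_field TYPE('a)" and gp: "general_position 4 F"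
  shows "\<exists>S. finite S \<and> archimedean_places \<subseteq> S \<and> S \<subseteq> places \<and> zariski_dense (solutions 4 F (S_integers S))"
proof -
  obtain E where E: "dual_to (F 0) (F 1) (F 2) E"
    using general_position_dual[OF gp, of 0 1 2] by auto
  obtain a b c where abc: "a \<noteq> 0" "b \<noteq> 0" "c \<noteq> 0" and F3: "\<And>v. scalar_product (F 3) v =
      a * scalar_product (F 0) v + b * scalar_product (F 1) v + c * scalar_product (F 2) v"
    by (rule general_position_coefficients[OF gp, of 0 1 2 3]) auto
  \<comment> \<open>The components are the values of \<open>F 0\<close>, \<open>F 1\<close>,
    \<open>F 2\<close>, and \<open>l\<close> scales the point. With
    \<open>r = a * c * s + b * w\<close>, the powers of \<open>c\<close> make the first two terms of
    \<open>F 3\<close> add up to \<open>l * c * r\<close>; so \<open>F 3\<close> is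
    \<open>l * c * r * (1 + w)\<close>, where \<open>1 + w = m * s\<close>.\<close>
  define \<Psi> :: "'a ^ 3 \<Rightarrow> 'a ^ 3" where "\<Psi> t = (let l = t $ 1; m = t $ 2; s = t $ 3; w = m * s - 1 in
    vector [l * (c * c) * s, l * c * w, l * w * (a * c * s + b * w)])" for t
  define h :: "'a ^ 3 \<Rightarrow> 'a" where "h v = v $ 1 * (v $ 2 * (v $ 3 * (a * v $ 1 + b * v $ 2)))" for v
  show ?thesis
  proof (rule zariski_dense_solutions[where C = "{a, b, c}" and \<Psi> = \<Psi> and h = h, OF nf E])
    show "polynomial_fun (\<lambda>t. \<Psi> t $ i)" for i
      using exhaust_3[of i] by (auto simp: \<Psi>_def Let_def vector_3 intro!: polynomial_fun_intros)
    show "polynomial_fun h"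
      unfolding h_def by (intro polynomial_fun_intros)
    have "a * axis 1 1 $ 1 + b * axis 1 1 $ (2::3) \<noteq> 0"
      using abc by (simp add: axis_def)
    moreover have "(1::'a ^ 3) $ i \<noteq> 0" for i
      by simp
    ultimately show "\<exists>v. h v \<noteq> 0"
      unfolding h_def by (intro polynomial_fun_mult_nonzero polynomial_fun_intros) blast+
  next
    fix v assume v: "h v \<noteq> 0"
    define X Y Z where "X = v $ 1" and "Y = v $ 2" and "Z = v $ 3"
    have nz: "X \<noteq> 0" "Y \<noteq> 0" "Z \<noteq> 0" "a * X + b * Y \<noteq> 0"
      using v by (auto simp: h_def X_def Y_def Z_def)
    \<comment> \<open>The first two components give
      \<open>a * c * s + b * w = (a * X + b * Y) / (l * c)\<close>, and the third can then be solved
      for \<open>l\<close>. After that \<open>X\<close> gives \<open>s\<close>, and \<open>Y\<close>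
      gives \<open>m * s - 1\<close>. The factors of \<open>h\<close> are what these divisions
      require.\<close>
    define l where "l = Y * (a * X + b * Y) / (c * c * Z)"
    define s where "s = X / (l * c * c)"
    define m where "m = (Y / (l * c) + 1) / s"
    have "l \<noteq> 0" "s \<noteq> 0"
      using nz abc by (auto simp: l_def s_def)
    then have w: "m * s - 1 = Y / (l * c)"
      by (simp add: m_def)
    have "l * (c * c) * s = X"
      using \<open>l \<noteq> 0\<close> abc by (simp add: s_def)
    moreover have "l * c * (m * s - 1) = Y"
      unfolding w using \<open>l \<noteq> 0\<close> abc by simp
    moreover have "l * (m * s - 1) * (a * c * s + b * (m * s - 1)) = Z"
    proof -
      have "a * c * s = a * X / (l * c)"
        using \<open>l \<noteq> 0\<close> abc by (simp add: s_def)
      then have "a * c * s + b * (m * s - 1) = (a * X + b * Y) / (l * c)"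
        unfolding w by (simp add: add_divide_distrib)
      then have "l * (m * s - 1) * (a * c * s + b * (m * s - 1)) =
          l * (Y / (l * c)) * ((a * X + b * Y) / (l * c))"
        unfolding w by simp
      also have "\<dots> = Y * (a * X + b * Y) / (c * c) / l"
        using \<open>l \<noteq> 0\<close> abc by simp
      also have "\<dots> = Z"
        using nz abc by (simp add: l_def)
      finally show ?thesis .
    qed
    ultimately have "\<Psi> (vector [l, m, s]) = v"
      by (simp add: \<Psi>_def Let_def vec_eq_iff forall_3 vector_3 X_def Y_def Z_def)
    then show "\<exists>t. \<Psi> t = v" ..
  next
    fix R and t :: "'a ^ 3"
    assume R: "field_subring R" and C: "{a, b, c} \<subseteq> R"
      and C_unit: "\<And>d. d \<in> {a, b, c} \<Longrightarrow> d \<noteq> 0 \<Longrightarrow> is_unit_in R d" and t: "\<And>i. is_unit_in R (t $ i)"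
    interpret field_subring R
      by fact
    define l m s w where "l = t $ 1" and "m = t $ 2" and "s = t $ 3" and "w = m * s - 1"
    note defs = l_def m_def s_def
    have lms: "is_unit_in R l" "is_unit_in R m" "is_unit_in R s" and "is_unit_in R c"
      using t C_unit abc by (auto simp: defs)
    have mem: "a \<in> R" "b \<in> R" "c \<in> R" "l \<in> R" "m \<in> R" "s \<in> R"
      using C lms by (auto simp: is_unit_in_def)
    then have w_mem: "w \<in> R"
      by (auto simp: w_def intro!: diff_mem mult_mem)
    let ?G = "\<lambda>i. scalar_product (F i) (E *v \<Psi> t)"
    let ?r = "a * c * s + b * w"
    have r_mem: "?r \<in> R"
      using mem w_mem by (auto intro!: add_mem mult_mem)
    have \<Psi>: "\<Psi> t $ 1 = l * (c * c) * s" "\<Psi> t $ 2 = l * c * w" "\<Psi> t $ 3 = l * w * ?r"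
      by (simp_all add: \<Psi>_def Let_def vector_3 defs w_def)
    have G': "?G 0 = \<Psi> t $ 1" "?G 1 = \<Psi> t $ 2" "?G 2 = \<Psi> t $ 3"
      using E by (simp_all add: dual_to_def)
    have "?G 3 = a * (l * (c * c) * s) + b * (l * c * w) + c * (l * w * ?r)"
      by (simp only: F3 G' \<Psi>)
    also have "\<dots> = l * c * m * (?r * s)"
      by (simp add: w_def algebra_simps)
    finally have "?G 3 = l * c * m * (?r * s)" .
    with G' have G: "?G 0 = l * c * c * (s * 1)" "?G 1 = l * c * (1 * w)" "?G 2 = l * (w * ?r)"
      "?G 3 = l * c * m * (?r * s)"
      unfolding \<Psi> by (simp_all add: mult_ac)
    have J: "ideal_gen R {s, w} = R" "ideal_gen R {1, ?r} = R"
    proof -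
      have "1 \<in> ideal_gen R {s, w}"
        by (rule ideal_gen_pairI[of m "- 1"]) (use mem in \<open>auto simp: w_def intro: minus_mem\<close>)
      then show "ideal_gen R {s, w} = R"
        by (rule ideal_gen_eq_ring) (use mem w_mem in auto)
      show "ideal_gen R {1, ?r} = R"
        by (intro ideal_gen_eq_ring ideal_gen_superset) (use r_mem in auto)
    qed
    have lt_4: "i = 0 \<or> i = 1 \<or> i = 2 \<or> i = 3" if "i < 4" for i :: nat
      using that by linarith
    have "cyclic_factorization 4 R ?G"
      unfolding cyclic_factorization_def
    proof (intro exI allI impI)
      let ?q = "\<lambda>i. [1, w, ?r, s] ! i" and ?\<epsilon> = "\<lambda>i. [l * c * c, l * c, l, l * c * m] ! i"
      fix i :: nat assume "i < 4"
      have "is_unit_in R (?\<epsilon> i)"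
        using lt_4[OF \<open>i < 4\<close>] lms \<open>is_unit_in R c\<close> by (elim disjE) (simp_all add: is_unit_in_mult)
      moreover have "?G i = ?\<epsilon> i * (?q ((i + 4 - 1) mod 4) * ?q i)"
        using lt_4[OF \<open>i < 4\<close>] G by (elim disjE) simp_all
      moreover have "ideal_gen R {?q ((i + 4 - 1) mod 4), ?q ((i + 1) mod 4)} = R"
        using lt_4[OF \<open>i < 4\<close>] J by (elim disjE) (simp_all add: insert_commute)
      ultimately show "is_unit_in R (?\<epsilon> i) \<and> ?G i = ?\<epsilon> i * (?q ((i + 4 - 1) mod 4) * ?q i) \<and>
          ideal_gen R {?q ((i + 4 - 1) mod 4), ?q ((i + 1) mod 4)} = R"
        by blast
    qed
    moreover have "\<Psi> t $ i \<in> ideal_gen R (?G ` {..<4})" for i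
      using exhaust_3[of i] E by (auto simp: dual_to_def intro!: ideal_gen_superset
        intro: image_eqI[of _ _ 0] image_eqI[of _ _ 1] image_eqI[of _ _ 2])
    moreover have "\<Psi> t $ i \<in> R" for i
      using exhaust_3[of i] mem w_mem r_mem by (auto simp: \<Psi> intro!: mult_mem)
    ultimately show "(\<forall>i. \<Psi> t $ i \<in> R \<and> \<Psi> t $ i \<in> ideal_gen R (?G ` {..<4})) \<and>
        cyclic_factorization 4 R ?G"
      by blast
  qed simp
qed

text \<open>
  In terms of \<open>X = F 0\<close>, \<open>Y = F 1\<close>, \<open>Z = F 3\<close>, the diagonals through \<open>p 0\<close> are \<open>P = a X + b Y\<close> and
  \<open>Q = d X + e Y\<close>, the torus coordinates are \<open>u = P F 4 / (X Z)\<close> and \<open>v = Q F 2 / (Y Z)\<close>, and \<open>K\<close> is the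
  conic to be contracted. Then \<open>u - A = K / (X Z)\<close> and \<open>v + B = K / (Y Z)\<close>, from which the \<open>q\<^sub>i\<close>
  are read off. On the conic all \<open>q\<^sub>i\<close> vanish, so \<open>J = (u - A, v + B)\<close> need not be the unit ideal.
\<close>

lemma dense_solutions_5:
  fixes F :: "nat \<Rightarrow> 'a::field_char_0 ^ 3"
  assumes nf: "number_field TYPE('a)" and gp: "general_position 5 F"
  shows "\<exists>S. finite S \<and> archimedean_places \<subseteq> S \<and> S \<subseteq> places \<and> zariski_dense (solutions 5 F (S_integers S))"
proof -
  obtain E where E: "dual_to (F 0) (F 1) (F 3) E"
    using general_position_dual[OF gp, of 0 1 3] by auto
  obtain a b c where abc: "a \<noteq> 0" "b \<noteq> 0" "c \<noteq> 0" and F2: "\<And>v. scalar_product (F 2) v =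
      a * scalar_product (F 0) v + b * scalar_product (F 1) v + c * scalar_product (F 3) v"
    by (rule general_position_coefficients[OF gp, of 0 1 3 2]) auto
  obtain d e f where def: "d \<noteq> 0" "e \<noteq> 0" "f \<noteq> 0" and F4: "\<And>v. scalar_product (F 4) v =
      d * scalar_product (F 0) v + e * scalar_product (F 1) v + f * scalar_product (F 3) v"
    by (rule general_position_coefficients[OF gp, of 0 1 3 4]) auto
  \<comment> \<open>The constants for which \<open>P * F 4 - A * X * Z\<close> and
    \<open>Q * F 2 + B * Y * Z\<close> become the same quadratic form \<open>K\<close>.\<close>
  define A B where "A = f * a - c * d" and "B = f * b - c * e"
  \<comment> \<open>At a point with coordinates \<open>X\<close>, \<open>Y\<close>, \<open>Z\<close>
    the entries are, in order, \<open>K P Q / (X Y Z^2)\<close>, \<open>K / (X Z)\<close>,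
    \<open>K P / (X Y Z)\<close>, \<open>K Q / (X Y Z)\<close> and \<open>K / (Y Z)\<close>,
    rewritten as polynomials in \<open>u\<close> and \<open>v\<close>.\<close>
  define q :: "'a ^ 3 \<Rightarrow> nat \<Rightarrow> 'a" where "q t i =
    (let u = t $ 2; v = t $ 3; x = u - A; y = v + B
     in [v * x - c * (e * x + d * y), x, b * x + a * y, e * x + d * y, y] ! i)" for t i
  define \<Psi> :: "'a ^ 3 \<Rightarrow> 'a ^ 3" where "\<Psi> t =
    vector [t $ 1 * (q t 4 * q t 0), t $ 1 * (q t 0 * q t 1), t $ 1 * (q t 2 * q t 3)]" for t
  \<comment> \<open>\<open>P\<close> and \<open>Q\<close> vanish on the lines joining
    \<open>p 0\<close> to \<open>p 2\<close> and to \<open>p 3\<close>. \<open>K\<close> vanishes at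
    all five points: for instance on \<open>Y = 0\<close> it is \<open>d X (a X + c Z)\<close>,
    which is zero at \<open>p 1\<close>.\<close>
  define P Q K :: "'a ^ 3 \<Rightarrow> 'a" where "P w = a * w $ 1 + b * w $ 2" and "Q w = d * w $ 1 + e * w $ 2"
    and "K w = P w * Q w + (c * d * w $ 1 * w $ 3 + f * b * w $ 2 * w $ 3)" for w
  define h where "h w = w $ 1 * (w $ 2 * (w $ 3 * (P w * (Q w * K w))))" for w
  show ?thesis
  proof (rule zariski_dense_solutions[where C = "{a, b, c, d, e, f}" and \<Psi> = \<Psi> and h = h, OF nf E])
    show "polynomial_fun (\<lambda>t. \<Psi> t $ i)" for i
      using exhaust_3[of i] by (auto simp: \<Psi>_def q_def Let_def vector_3 intro!: polynomial_fun_intros)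
    have poly: "polynomial_fun P" "polynomial_fun Q" "polynomial_fun K"
      unfolding K_def P_def Q_def by (intro polynomial_fun_intros)+
    then show "polynomial_fun h"
      unfolding h_def by (intro polynomial_fun_intros)
    have "P (axis 1 1) \<noteq> 0" "Q (axis 1 1) \<noteq> 0" "K (axis 1 1) \<noteq> 0"
      using abc def by (simp_all add: P_def Q_def K_def axis_def)
    moreover have "(1::'a ^ 3) $ i \<noteq> 0" for i
      by simp
    ultimately show "\<exists>w. h w \<noteq> 0"
      unfolding h_def using poly by (intro polynomial_fun_mult_nonzero polynomial_fun_intros) blast+
  next
    fix w assume w: "h w \<noteq> 0"
    define X Y Z where "X = w $ 1" and "Y = w $ 2" and "Z = w $ 3"
    define p r k where "p = a * X + b * Y" and "r = d * X + e * Y" and "k = p * r + (c * d * X * Z + f * b * Y * Z)"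
    have nz: "X \<noteq> 0" "Y \<noteq> 0" "Z \<noteq> 0" "p \<noteq> 0" "r \<noteq> 0" "k \<noteq> 0"
      using w by (auto simp: h_def X_def Y_def Z_def p_def r_def k_def P_def Q_def K_def)
    \<comment> \<open>\<open>l\<close> is the inverse of the common factor
      \<open>K^2 P Q / (X^2 Y^2 Z^3)\<close> by which the products \<open>q 4 * q 0\<close>,
      \<open>q 0 * q 1\<close> and \<open>q 2 * q 3\<close> differ from \<open>X\<close>,
      \<open>Y\<close> and \<open>Z\<close>.\<close>
    define u v l where "u = p * (r + f * Z) / (X * Z)" and "v = r * (p + c * Z) / (Y * Z)"
      and "l = X * X * (Y * Y) * (Z * Z * Z) / (k * k * p * r)"
    define x y where "x = k / (X * Z)" and "y = k / (Y * Z)"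
    have x: "u - A = x" and y: "v + B = y"
      using nz by (simp_all add: u_def v_def x_def y_def A_def B_def k_def p_def field_simps)
        (simp_all add: r_def p_def algebra_simps)
    have q2: "b * x + a * y = k * p / (X * Y * Z)" and q3: "e * x + d * y = k * r / (X * Y * Z)"
      using nz(1-3) by (simp_all add: x_def y_def p_def r_def field_simps)
    have q0: "v * x - c * (k * r / (X * Y * Z)) = k * p * r / (X * Y * (Z * Z))"
      using nz(1-3) by (simp add: v_def x_def field_simps)
    define t :: "'a ^ 3" where "t = vector [l, u, v]"
    have "q t 0 = k * p * r / (X * Y * (Z * Z))" "q t 1 = x" "q t 2 = k * p / (X * Y * Z)"
      "q t 3 = k * r / (X * Y * Z)" "q t 4 = y" "t $ 1 = l"
      unfolding q_def t_def by (simp_all add: Let_def vector_3 x y flip: q0 q2 q3)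
    moreover have "l * (y * (k * p * r / (X * Y * (Z * Z)))) = X"
      "l * (k * p * r / (X * Y * (Z * Z)) * x) = Y"
      "l * (k * p / (X * Y * Z) * (k * r / (X * Y * Z))) = Z"
      using nz by (simp_all add: l_def x_def y_def)
    ultimately have "\<Psi> t = w"
      by (simp only: \<Psi>_def vec_eq_iff forall_3 vector_3 X_def Y_def Z_def)
    then show "\<exists>t. \<Psi> t = w" ..
  next
    fix R and t :: "'a ^ 3"
    assume R: "field_subring R" and C: "{a, b, c, d, e, f} \<subseteq> R"
      and C_unit: "\<And>x. x \<in> {a, b, c, d, e, f} \<Longrightarrow> x \<noteq> 0 \<Longrightarrow> is_unit_in R x"
      and t: "\<And>i. is_unit_in R (t $ i)"
    interpret field_subring R
      by fact
    define l u v x y where "l = t $ 1" and "u = t $ 2" and "v = t $ 3" and "x = u - A" and "y = v + B"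
    note defs = l_def u_def v_def
    define q0 q2 q3 where "q0 = v * x - c * (e * x + d * y)" and "q2 = b * x + a * y" and "q3 = e * x + d * y"
    have luv: "is_unit_in R l" "is_unit_in R u" "is_unit_in R v"
      using t by (auto simp: defs)
    have "is_unit_in R b" "is_unit_in R d"
      using C_unit abc def by auto
    then have inv: "inverse u \<in> R" "inverse v \<in> R" "inverse b \<in> R" "inverse d \<in> R"
      and nz: "u \<noteq> 0" "v \<noteq> 0" "b \<noteq> 0" "d \<noteq> 0"
      using luv by (auto simp: is_unit_in_def)
    have mem: "a \<in> R" "b \<in> R" "c \<in> R" "d \<in> R" "e \<in> R" "f \<in> R" "l \<in> R" "u \<in> R" "v \<in> R"
      using C luv by (auto simp: is_unit_in_def)
    note closed = add_mem mult_mem diff_mem minus_mem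
    have xy_mem: "x \<in> R" "y \<in> R"
      using mem by (auto simp: x_def y_def A_def B_def intro!: closed)
    then have q_mem: "q0 \<in> R" "q2 \<in> R" "q3 \<in> R"
      using mem by (auto simp: q0_def q2_def q3_def intro!: closed)
    \<comment> \<open>These identities make \<open>F 4\<close> and \<open>F 2\<close> factor with
      the extra units \<open>u\<close> and \<open>v\<close>. The second is the definition of
      \<open>q0\<close>; for the first,
      \<open>v * x - c * q3 + f * q2 = (v + B) * x + A * y = (x + A) * y\<close>.\<close>
    have uy: "q0 + f * q2 = u * y" and vx: "q0 + c * q3 = v * x"
      by (simp_all add: q0_def q2_def q3_def x_def y_def A_def B_def algebra_simps)
    let ?G = "\<lambda>i. scalar_product (F i) (E *v \<Psi> t)"
    have \<Psi>: "\<Psi> t $ 1 = l * (y * q0)" "\<Psi> t $ 2 = l * (q0 * x)" "\<Psi> t $ 3 = l * (q2 * q3)"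
      by (simp_all add: \<Psi>_def q_def Let_def vector_3 q0_def q2_def q3_def x_def y_def defs)
    have G: "?G 0 = \<Psi> t $ 1" "?G 1 = \<Psi> t $ 2" "?G 3 = \<Psi> t $ 3"
      using E by (simp_all add: dual_to_def)
    have "?G 2 = a * (l * (y * q0)) + b * (l * (q0 * x)) + c * (l * (q2 * q3))"
      by (simp only: F2 G \<Psi>)
    also have "\<dots> = l * (q2 * (q0 + c * q3))"
      by (simp add: q2_def algebra_simps)
    finally have G2: "?G 2 = l * v * (x * q2)"
      by (simp add: vx mult_ac)
    have "?G 4 = d * (l * (y * q0)) + e * (l * (q0 * x)) + f * (l * (q2 * q3))"
      by (simp only: F4 G \<Psi>)
    also have "\<dots> = l * (q3 * (q0 + f * q2))"
      by (simp add: q3_def algebra_simps)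
    finally have G4: "?G 4 = l * u * (q3 * y)"
      by (simp add: uy mult_ac)
    \<comment> \<open>A pair containing \<open>x\<close> or \<open>y\<close> yields the other one by
      inverting \<open>d\<close> or \<open>b\<close>. The pairs \<open>q0, q2\<close> and
      \<open>q3, q0\<close> contain neither: there \<open>y\<close> is obtained by inverting
      \<open>u\<close>, respectively \<open>x\<close> by inverting \<open>v\<close>, before the same
      relations apply.\<close>
    have x_q2: "x = inverse b * q2 - inverse b * a * y"
      using nz by (simp add: q2_def field_simps)
    have y_q3: "y = inverse d * q3 - inverse d * e * x"
      using nz by (simp add: q3_def field_simps)
    have y_q0: "y = inverse u * q0 + inverse u * f * q2"
      using uy nz by (simp add: field_simps)
    have x_q0: "x = inverse v * c * q3 + inverse v * q0"
      using vx nz by (simp add: field_simps)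
    let ?J = "ideal_gen R {x, y}"
    have gens: "q0 \<in> ?J" "q2 \<in> ?J" "q3 \<in> ?J" "x \<in> ?J" "y \<in> ?J"
    proof -
      show "q0 \<in> ?J"
        by (rule ideal_gen_pairI[of "v - c * e" "- (c * d)"])
          (use mem in \<open>auto simp: q0_def algebra_simps intro!: closed\<close>)
      show "q2 \<in> ?J"
        by (rule ideal_gen_pairI[of b a]) (use mem in \<open>auto simp: q2_def\<close>)
      show "q3 \<in> ?J"
        by (rule ideal_gen_pairI[of e d]) (use mem in \<open>auto simp: q3_def\<close>)
    qed (auto intro: ideal_gen_superset)
    have J1: "ideal_gen R {q0, q2} = ?J"
    proof (rule ideal_gen_pair_eqI)
      show y: "y \<in> ideal_gen R {q0, q2}"
        using y_q0 by (rule ideal_gen_pairI[rotated 2]) (use mem inv in \<open>auto intro!: closed\<close>)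
      have "inverse b * q2 + - (inverse b * a) * y \<in> ideal_gen R {q0, q2}"
        by (intro submodule_add[OF submodule_ideal_gen] ideal_gen_multiple[of "inverse b"]
            submodule_scale[OF submodule_ideal_gen _ y] closed) (use mem inv in auto)
      then show "x \<in> ideal_gen R {q0, q2}"
        by (subst x_q2) (simp add: mult_ac)
    qed (use gens in auto)
    have J2: "ideal_gen R {x, q3} = ?J"
    proof (rule ideal_gen_pair_eqI)
      show "y \<in> ideal_gen R {x, q3}"
        by (rule ideal_gen_pairI[of "- (inverse d * e)" "inverse d"])
          (use mem inv y_q3 in \<open>auto intro!: closed\<close>)
    qed (use gens in \<open>auto intro: ideal_gen_superset\<close>)
    have J3: "ideal_gen R {q2, y} = ?J"
    proof (rule ideal_gen_pair_eqI)
      show "x \<in> ideal_gen R {q2, y}"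
        by (rule ideal_gen_pairI[of "inverse b" "- (inverse b * a)"])
          (use mem inv x_q2 in \<open>auto intro!: closed\<close>)
    qed (use gens in \<open>auto intro: ideal_gen_superset\<close>)
    have J4: "ideal_gen R {q3, q0} = ?J"
    proof (rule ideal_gen_pair_eqI)
      show x: "x \<in> ideal_gen R {q3, q0}"
        using x_q0 by (rule ideal_gen_pairI[rotated 2]) (use mem inv in \<open>auto intro!: closed\<close>)
      have "inverse d * q3 + - (inverse d * e) * x \<in> ideal_gen R {q3, q0}"
        by (intro submodule_add[OF submodule_ideal_gen] ideal_gen_multiple[of "inverse d"]
            submodule_scale[OF submodule_ideal_gen _ x] closed) (use mem inv in auto)
      then show "y \<in> ideal_gen R {q3, q0}"
        by (subst y_q3) (simp add: mult_ac)
    qed (use gens in auto)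
    have lt_5: "i = 0 \<or> i = 1 \<or> i = 2 \<or> i = 3 \<or> i = 4" if "i < 5" for i :: nat
      using that by linarith
    have "cyclic_factorization 5 R ?G"
      unfolding cyclic_factorization_def
    proof (intro exI allI impI)
      let ?q = "\<lambda>i. [q0, x, q2, q3, y] ! i" and ?\<epsilon> = "\<lambda>i. [l, l, l * v, l, l * u] ! i"
      fix i :: nat assume "i < 5"
      have "is_unit_in R (?\<epsilon> i)"
        using lt_5[OF \<open>i < 5\<close>] luv by (elim disjE) (simp_all add: is_unit_in_mult)
      moreover have "?G i = ?\<epsilon> i * (?q ((i + 5 - 1) mod 5) * ?q i)"
        using lt_5[OF \<open>i < 5\<close>] G G2 G4 \<Psi> by (elim disjE) simp_all
      moreover have "ideal_gen R {?q ((i + 5 - 1) mod 5), ?q ((i + 1) mod 5)} = ?J"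
        using lt_5[OF \<open>i < 5\<close>] J1 J2 J3 J4 by (elim disjE) (simp_all add: insert_commute)
      ultimately show "is_unit_in R (?\<epsilon> i) \<and> ?G i = ?\<epsilon> i * (?q ((i + 5 - 1) mod 5) * ?q i) \<and>
          ideal_gen R {?q ((i + 5 - 1) mod 5), ?q ((i + 1) mod 5)} = ?J"
        by blast
    qed
    moreover have "\<Psi> t $ i \<in> ideal_gen R (?G ` {..<5})" for i
      using exhaust_3[of i] E by (auto simp: dual_to_def intro!: ideal_gen_superset
        intro: image_eqI[of _ _ 0] image_eqI[of _ _ 1] image_eqI[of _ _ 3])
    moreover have "\<Psi> t $ i \<in> R" for i
      using exhaust_3[of i] mem xy_mem q_mem by (auto simp: \<Psi> intro!: mult_mem)
    ultimately show "(\<forall>i. \<Psi> t $ i \<in> R \<and> \<Psi> t $ i \<in> ideal_gen R (?G ` {..<5})) \<and>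
        cyclic_factorization 5 R ?G"
      by blast
  qed simp
qed

theorem theorem9:
  fixes F :: "nat \<Rightarrow> 'a::field_char_0 ^ 3" and n :: nat
  assumes "number_field TYPE('a)"
    and "1 \<le> n" and "n \<le> 5"
    and "general_position n F"
  shows "\<exists>S :: ('a \<Rightarrow> real) set set.
    finite S \<and> archimedean_places \<subseteq> S \<and> S \<subseteq> places \<and>
    zariski_dense {v :: 'a ^ 3.
      (\<forall>j. v $ j \<in> S_integers S) \<and>
      (\<forall>i<n.
        let R = S_integers S;
            F_prev = scalar_product (F ((i + n - 1) mod n)) v;
            F_this = scalar_product (F i) v;
            F_next = scalar_product (F ((i + 1) mod n)) v
        in (\<lambda>a. F_this * a) ` ideal_gen R {v $ 1, v $ 2, v $ 3} =
           ideal_mult R (ideal_gen R {F_prev, F_this}) (ideal_gen R {F_this, F_next}))}"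
proof -
  have "\<exists>S. finite S \<and> archimedean_places \<subseteq> S \<and> S \<subseteq> places \<and> zariski_dense (solutions n F (S_integers S))"
  proof -
    have "n \<le> 3 \<or> n = 4 \<or> n = 5"
      using \<open>n \<le> 5\<close> by linarith
    then show ?thesis
      using dense_solutions_le_3[OF assms(1,2) _ assms(4)] dense_solutions_4[OF assms(1)]
        dense_solutions_5[OF assms(1)] assms(4) by blast
  qed
  then show ?thesis
    by (simp add: solutions_def Let_def)
qed

end
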